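(* Let $\varepsilon>0$. If $X\cap\operatorname{dom}(V)\subset\mathbb{R}^n_+$ has a finite diameter $M\in\mathbb{R}_+$ and the function $x\mapsto c^\top x+V(x)$ is Lipschitz with constant $L$ (for the Euclidean norm), then the adaptive partition-based algorithm described in the context (for any choice of the adapted partitions $\mathcal{P}_{x_k}$) finds an $\varepsilon$-solution of the problem $\min_{x\in X}\{c^\top x+V(x)\}$ in at most $$\left(\frac{\sqrt{n}\,L\,M}{\varepsilon}+1\right)^n$$ iterations.
   Context: Setting. $(\Omega,\mathcal{A},\mathbb{P})$ is a probability space, $\Xi:=\mathbb{R}^{l\times n}\times\mathbb{R}^l$, and $\boldsymbol{\xi}=(\boldsymbol{T},\boldsymbol{h})$ is an integrable random variable with values in $\Xi$. The matrix $W\in\mathbb{R}^{l\times m}$ and the vectors $q\in\mathbb{R}^m$, $c\in\mathbb{R}^n$ are deterministic, and $X:=\{x\in\mathbb{R}^n_+\mid Ax=b\}$ for a given matrix $A$ and vector $b$. For $x\in\mathbb{R}^n$ and $\xi=(T,h)\in\Xi$, the recourse cost is $$Q(x,\xi):=\min_{y\in\mathbb{R}^m_+}\{q^\top y\mid Tx+Wy=h\},$$ with value $+\infty$ if infeasible. It is assumed throughout that $D:=\{\lambda\in\mathbb{R}^l\mid W^\top\lambda\leq q\}\neq\emptyset$, so that $Q(x,\xi)=\sup_{\lambda\in D}(h-Tx)^\top\lambda$. Set $V(x):=\mathbb{E}[Q(x,\boldsymbol{\xi})]\in(-\infty,+\infty]$ and $\operatorname{dom}(V):=\{x\mid V(x)<+\infty\}$.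 The two-stage problem is $\min_{x\in X}\{c^\top x+V(x)\}$; an $\varepsilon$-solution is a point $x\in X$ with $c^\top x+V(x)\leq\inf_{x'\in X}\{c^\top x'+V(x')\}+\varepsilon$. Saying that the algorithm finds an $\varepsilon$-solution in at most $K$ iterations means that one of the points $x_k$ that it computes at an iteration $k\leq K$ is an $\varepsilon$-solution. For measurable $P\subset\Xi$ write $\mathbb{P}[P]:=\mathbb{P}[\boldsymbol{\xi}\in P]$ and $\mathbb{E}[\cdot\mid P]:=\mathbb{E}[\cdot\mid\boldsymbol{\xi}\in P]$. A $\mathbb{P}$-partition of $\Xi$ is a partition of $\Xi$ (into measurable sets) whose elements are considered up to $\mathbb{P}$-negligible sets (for the law of $\boldsymbol{\xi}$). For a finite $\mathbb{P}$-partition $\mathcal{P}$, $$V_{\mathcal{P}}(x):=\sum_{P\in\mathcal{P}}\mathbb{P}[P]\,Q\big(x,\mathbb{E}[\boldsymbol{\xi}\mid P]\big),$$ with the convention that a term with $\mathbb{P}[P]=0$ equals $0$. A finite $\mathbb{P}$-partition $\mathcal{P}$ is adapted to $x$ if $V_{\mathcal{P}}(x)=V(x)$. The common refinement is $\mathcal{P}\wedge\mathcal{R}:=\{P\cap R\mid P\in\mathcal{P},R\in\mathcal{R}\}$. Algorithm (adaptive partition-based method). Initialize $k=0$, $z^U_0=+\infty$, $z^L_0=-\infty$, $\mathcal{P}^0=\{\Xi\}$. While $z^U_k-z^L_k>\varepsilon$, perform an iteration: 1. $k\leftarrow k+1$; 2. set $z^L_k:=\min_{x\in X}\{c^\top x+V_{\mathcal{P}^{k-1}}(x)\}$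 and let $x_k$ be an optimal solution; 3. choose a finite $\mathbb{P}$-partition $\mathcal{P}_{x_k}$ of $\Xi$ adapted to $x_k$; 4. set $\mathcal{P}^k:=\mathcal{P}^{k-1}\wedge\mathcal{P}_{x_k}$; 5. set $z^U_k:=\min\big(z^U_{k-1},\,c^\top x_k+V_{\mathcal{P}^k}(x_k)\big)$. *)

theory Defs
  imports "HOL-Probability.Probability"
begin

text \<open>Expectation of an extended-real random variable as positive part minus negative part
  (\<^const>\<open>e2ennreal\<close> sends negative values to 0).  It is meaningful if one of the two parts is finite.
  For the recourse cost below the negative part is finite, since
  \<open>Q(x,\<xi>) \<ge> (h - T x) \<bullet> \<lambda>\<close> for every dual feasible \<open>\<lambda>\<close>.\<close>

definition ereal_expectation :: "'a measure \<Rightarrow> ('a \<Rightarrow> ereal) \<Rightarrow> ereal" where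
  "ereal_expectation M f =
     enn2ereal (\<integral>\<^sup>+ \<omega>. e2ennreal (f \<omega>) \<partial>M) - enn2ereal (\<integral>\<^sup>+ \<omega>. e2ennreal (- f \<omega>) \<partial>M)"

text \<open>Vector inequalities are componentwise.\<close>

definition first_stage :: "real^'n^'p \<Rightarrow> real^'p \<Rightarrow> (real^'n) set" where
  "first_stage A b = {x. 0 \<le> x \<and> A *v x = b}"

definition dual_feasible :: "real^'m^'l \<Rightarrow> real^'m \<Rightarrow> (real^'l) set" where
  "dual_feasible W q = {v. transpose W *v v \<le> q}"

text \<open>The infimum over the empty set is \<open>\<infinity>\<close>.  If the dual is feasible, the linear program is
  bounded below, so that the infimum is attained whenever the program is feasible.\<close>

definition recourse ::
    "real^'m^'l \<Rightarrow> real^'m \<Rightarrow> real^'n \<Rightarrow> (real^'n^'l) \<times> (real^'l) \<Rightarrow> ereal" where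
  "recourse W q x z = (INF y \<in> {y. 0 \<le> y \<and> fst z *v x + W *v y = snd z}. ereal (q \<bullet> y))"

definition exp_recourse ::
    "'a measure \<Rightarrow> ('a \<Rightarrow> (real^'n^'l) \<times> (real^'l)) \<Rightarrow> real^'m^'l \<Rightarrow> real^'m \<Rightarrow> real^'n \<Rightarrow> ereal" where
  "exp_recourse M \<xi> W q x = ereal_expectation M (\<lambda>\<omega>. recourse W q x (\<xi> \<omega>))"

definition recourse_dom ::
    "'a measure \<Rightarrow> ('a \<Rightarrow> (real^'n^'l) \<times> (real^'l)) \<Rightarrow> real^'m^'l \<Rightarrow> real^'m \<Rightarrow> (real^'n) set" where
  "recourse_dom M \<xi> W q = {x. exp_recourse M \<xi> W q x < \<infinity>}"

definition total_cost ::
    "'a measure \<Rightarrow> ('a \<Rightarrow> (real^'n^'l) \<times> (real^'l)) \<Rightarrow> real^'m^'l \<Rightarrow> real^'m \<Rightarrow> real^'n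
      \<Rightarrow> real^'n \<Rightarrow> ereal" where
  "total_cost M \<xi> W q c x = ereal (c \<bullet> x) + exp_recourse M \<xi> W q x"

definition eps_solution ::
    "'a measure \<Rightarrow> ('a \<Rightarrow> (real^'n^'l) \<times> (real^'l)) \<Rightarrow> real^'m^'l \<Rightarrow> real^'m \<Rightarrow> real^'n
      \<Rightarrow> (real^'n) set \<Rightarrow> real \<Rightarrow> real^'n \<Rightarrow> bool" where
  "eps_solution M \<xi> W q c X \<epsilon> x \<longleftrightarrow>
     x \<in> X \<and> total_cost M \<xi> W q c x \<le> (INF x' \<in> X. total_cost M \<xi> W q c x') + ereal \<epsilon>"

text \<open>An extended-real function is Lipschitz on a set if it is finite there and Lipschitz as a
  real-valued function.\<close>

definition ereal_lipschitz_on :: "real \<Rightarrow> 'b::metric_space set \<Rightarrow> ('b \<Rightarrow> ereal) \<Rightarrow> bool" where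
  "ereal_lipschitz_on L S f \<longleftrightarrow> (\<exists>g. L-lipschitz_on S g \<and> (\<forall>x\<in>S. f x = ereal (g x)))"

text \<open>Conditional expectation given the event \<open>\<xi> \<in> P\<close>; it is 0 if that event is negligible.\<close>

definition cond_mean :: "'a measure \<Rightarrow> ('a \<Rightarrow> 'b::euclidean_space) \<Rightarrow> 'b set \<Rightarrow> 'b" where
  "cond_mean M \<xi> P = (LINT \<omega>:(\<xi> -` P \<inter> space M)|M. \<xi> \<omega>) /\<^sub>R measure (distr M borel \<xi>) P"

text \<open>A finite partition up to negligible sets is given by representatives of its elements: they
  are measurable, and they are pairwise disjoint and cover the space up to a negligible set.
  Nothing below depends on the choice of the representatives.\<close>

definition finite_ae_partition ::
    "'a measure \<Rightarrow> ('a \<Rightarrow> 'b::euclidean_space) \<Rightarrow> 'b set set \<Rightarrow> bool" where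
  "finite_ae_partition M \<xi> \<P> \<longleftrightarrow>
     finite \<P> \<and> \<P> \<subseteq> sets borel \<and>
     (\<forall>P\<in>\<P>. \<forall>R\<in>\<P>. P \<noteq> R \<longrightarrow> P \<inter> R \<in> null_sets (distr M borel \<xi>)) \<and>
     UNIV - \<Union>\<P> \<in> null_sets (distr M borel \<xi>)"

definition common_refinement :: "'b set set \<Rightarrow> 'b set set \<Rightarrow> 'b set set" where
  "common_refinement \<P> \<R> = {P \<inter> R | P R. P \<in> \<P> \<and> R \<in> \<R>}"

text \<open>Negligible elements contribute 0, since \<open>0 * \<infinity> = 0\<close> in \<^typ>\<open>ereal\<close>.\<close>

definition partition_recourse ::
    "'a measure \<Rightarrow> ('a \<Rightarrow> (real^'n^'l) \<times> (real^'l)) \<Rightarrow> real^'m^'l \<Rightarrow> real^'m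
      \<Rightarrow> ((real^'n^'l) \<times> (real^'l)) set set \<Rightarrow> real^'n \<Rightarrow> ereal" where
  "partition_recourse M \<xi> W q \<P> x =
     (\<Sum>P\<in>\<P>. ereal (measure (distr M borel \<xi>) P) * recourse W q x (cond_mean M \<xi> P))"

definition adapted_partition ::
    "'a measure \<Rightarrow> ('a \<Rightarrow> (real^'n^'l) \<times> (real^'l)) \<Rightarrow> real^'m^'l \<Rightarrow> real^'m
      \<Rightarrow> real^'n \<Rightarrow> ((real^'n^'l) \<times> (real^'l)) set set \<Rightarrow> bool" where
  "adapted_partition M \<xi> W q x \<P> \<longleftrightarrow>
     finite_ae_partition M \<xi> \<P> \<and> partition_recourse M \<xi> W q \<P> x = exp_recourse M \<xi> W q x"

definition partition_cost ::
    "'a measure \<Rightarrow> ('a \<Rightarrow> (real^'n^'l) \<times> (real^'l)) \<Rightarrow> real^'m^'l \<Rightarrow> real^'m \<Rightarrow> real^'n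
      \<Rightarrow> ((real^'n^'l) \<times> (real^'l)) set set \<Rightarrow> real^'n \<Rightarrow> ereal" where
  "partition_cost M \<xi> W q c \<P> x = ereal (c \<bullet> x) + partition_recourse M \<xi> W q \<P> x"

text \<open>A complete execution performing \<open>N\<close> iterations, where \<open>N = \<infinity>\<close> if the loop does not terminate.
  At iteration \<open>k \<ge> 1\<close>, \<open>x k\<close> is the computed point, \<open>R k\<close> the chosen partition adapted to \<open>x k\<close>,
  \<open>\<P> k\<close> the current partition, and \<open>zL k\<close>, \<open>zU k\<close> are the bounds.  The values of the sequences
  beyond \<open>N\<close>, and those of \<open>x\<close> and \<open>R\<close> at 0, are irrelevant.\<close>

definition apm_execution ::
    "'a measure \<Rightarrow> ('a \<Rightarrow> (real^'n^'l) \<times> (real^'l)) \<Rightarrow> real^'m^'l \<Rightarrow> real^'m \<Rightarrow> real^'n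
      \<Rightarrow> (real^'n) set \<Rightarrow> real \<Rightarrow> enat \<Rightarrow> (nat \<Rightarrow> real^'n)
      \<Rightarrow> (nat \<Rightarrow> ((real^'n^'l) \<times> (real^'l)) set set)
      \<Rightarrow> (nat \<Rightarrow> ((real^'n^'l) \<times> (real^'l)) set set)
      \<Rightarrow> (nat \<Rightarrow> ereal) \<Rightarrow> (nat \<Rightarrow> ereal) \<Rightarrow> bool" where
  "apm_execution M \<xi> W q c X \<epsilon> N x R \<P> zL zU \<longleftrightarrow>
     zU 0 = \<infinity> \<and> zL 0 = -\<infinity> \<and> \<P> 0 = {UNIV} \<and>
     (\<forall>k. 1 \<le> k \<and> enat k \<le> N \<longrightarrow>
        zU (k - 1) - zL (k - 1) > ereal \<epsilon> \<and>
        is_arg_min (partition_cost M \<xi> W q c (\<P> (k - 1))) (\<lambda>x'. x' \<in> X) (x k) \<and>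
        zL k = partition_cost M \<xi> W q c (\<P> (k - 1)) (x k) \<and>
        adapted_partition M \<xi> W q (x k) (R k) \<and>
        \<P> k = common_refinement (\<P> (k - 1)) (R k) \<and>
        zU k = min (zU (k - 1)) (partition_cost M \<xi> W q c (\<P> k) (x k))) \<and>
     (\<forall>n. N = enat n \<longrightarrow> \<not> (zU n - zL n > ereal \<epsilon>))"

end

theory Submission
  imports Defs
begin

text \<open>The cost \<open>f\<^sub>k\<close> of the current partition is convex and, by linear programming duality and
  Jensen's inequality, minorizes the cost \<open>f\<close>; it agrees with \<open>f\<close> at \<open>x\<^sub>1, \<dots>, x\<^sub>k\<close> because refining
  a partition can only increase its cost.  So a point \<open>x\<^sub>j\<close> that is not an \<open>\<epsilon>\<close>-solution
  satisfies \<open>f\<^sub>k x\<^sub>j > min f\<^sub>k + \<epsilon>\<close>.  If \<open>f\<^sub>k\<close> were Lipschitz with constant \<open>L\<close>, the next iterate would be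
  at distance more than \<open>\<epsilon> / L\<close> from \<open>x\<^sub>j\<close>.  But \<open>f\<close> is only Lipschitz on the polyhedron \<open>X\<close>, and
  \<open>f\<^sub>k\<close> may be arbitrarily steep at the boundary of \<open>X\<close>.  The separation does hold for two
  iterates with the same support, since the segment between them can be prolonged within \<open>X\<close>.

  As \<open>X\<close> is bounded, its points with support \<open>S\<close> span an affine space of dimension less than
  \<open>card S\<close>.  With \<open>r = L D / \<epsilon>\<close>, comparing volumes shows that at most \<open>(1 + 2 r)\<close> to the power
  \<open>card S - 1\<close> of them are pairwise separated, and even at most \<open>1 + r\<close> of them if \<open>card S = 2\<close>.
  Summed over all nonempty \<open>S\<close>, this is at most \<open>(sqrt n r + 1)\<^sup>n - 1\<close> as soon as \<open>r > 1\<close>; and if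
  \<open>r \<le> 1\<close>, every point of \<open>X\<close> is an \<open>\<epsilon>\<close>-solution.\<close>

section \<open>Linear programming duality for the recourse cost\<close>

lemma recourse_weak_duality:
  assumes "v \<in> dual_feasible W q"
  shows "ereal (v \<bullet> (snd z - fst z *v x)) \<le> recourse W q x z"
  unfolding recourse_def
proof (rule INF_greatest, clarsimp)
  fix y assume y: "0 \<le> y" "fst z *v x + W *v y = snd z"
  have "v \<bullet> (snd z - fst z *v x) = v \<bullet> (W *v y)"
    using y(2) by (metis add_diff_cancel_left')
  also have "\<dots> = (transpose W *v v) \<bullet> y"
    by (simp add: dot_lmul_matrix flip: vector_transpose_matrix)
  also have "\<dots> \<le> q \<bullet> y"
    unfolding inner_vec_def
    using assms y(1) by (intro sum_mono) (auto simp: dual_feasible_def less_eq_vec_def intro!: mult_right_mono)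
  finally show "v \<bullet> (snd z - fst z *v x) \<le> q \<bullet> y" .
qed

text \<open>A Farkas argument: the hypothesis says that \<open>(u, t)\<close> lies outside the cone
  generated by \<open>(0, 1)\<close> and the pairs of a column of \<open>W\<close> with its cost. A
  hyperplane separating the point from this closed cone becomes a dual feasible vector after
  normalisation.\<close>

lemma dual_certificate:
  fixes W :: "real^'m^'l"
  assumes "dual_feasible W q \<noteq> {}"
    and no: "\<And>y. 0 \<le> y \<Longrightarrow> W *v y = u \<Longrightarrow> t < q \<bullet> y"
  shows "\<exists>v\<in>dual_feasible W q. t < v \<bullet> u"
proof -
  define h where "h p = (W *v fst p, q \<bullet> fst p + snd p)" for p :: "(real^'m) \<times> real"
  define C where "C = {p :: (real^'m) \<times> real. 0 \<le> fst p \<and> 0 \<le> snd p}"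
  define G where "G = insert (0, 1) (range (\<lambda>i. (W *v axis i 1, q $ i)))"
  have h: "linear h"
    unfolding h_def by (rule linearI) (auto simp: matrix_vector_right_distrib inner_add_right
        matrix_vector_mult_scaleR algebra_simps)
  have "convex_cone C"
    by (auto simp: convex_cone_iff C_def less_eq_vec_def zero_prod_def)
  then have "convex_cone (h ` C)" using h by (intro convex_cone_linear_image conjI)
  moreover have "(0, 1) \<in> h ` C"
    by (rule image_eqI[of _ _ "(0, 1)"]) (auto simp: h_def C_def)
  moreover have "(W *v axis i 1, q $ i) \<in> h ` C" for i
    by (rule image_eqI[of _ _ "(axis i 1, 0)"]) (auto simp: h_def C_def inner_axis less_eq_vec_def, simp add: axis_def)
  \<comment> \<open>One inclusion suffices: it keeps \<open>(u, t)\<close> out of the hull, and the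
    hull of a finite set is closed, as strict separation requires.\<close>
  ultimately have "convex_cone hull G \<subseteq> h ` C"
    by (intro hull_minimal) (auto simp: G_def)
  moreover have "(u, t) \<notin> h ` C"
  proof
    assume "(u, t) \<in> h ` C"
    then obtain y s where "0 \<le> y" "0 \<le> s" "u = W *v y" "t = q \<bullet> y + s"
      by (auto simp: C_def h_def)
    with no[of y] show False by simp
  qed
  moreover have "finite G" by (simp add: G_def)
  ultimately obtain a c where sep: "a \<bullet> (u, t) < c" "\<And>p. p \<in> convex_cone hull G \<Longrightarrow> c < a \<bullet> p"
    using separating_hyperplane_closed_point[OF convex_convex_cone_hull closed_convex_cone_hull, of G "(u, t)"]
    by blast
  have c0: "c < 0"
    using sep(2)[OF convex_cone_hull_contains_0] by simp
  \<comment> \<open>If \<open>a\<close> were negative on a generator, a positive multiple of that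
    generator would reach the value \<open>c\<close> exactly, against the strict separation.\<close>
  have nonneg: "0 \<le> a \<bullet> p" if "p \<in> G" for p
  proof (rule ccontr)
    assume neg: "\<not> 0 \<le> a \<bullet> p"
    have "(c / (a \<bullet> p)) *\<^sub>R p \<in> convex_cone hull G"
      using neg c0 that by (intro conicD[OF conic_convex_cone_hull] hull_inc divide_nonpos_nonpos) auto
    from sep(2)[OF this] neg show False by simp
  qed
  obtain l \<beta> where a: "a = (l, \<beta>)" by (cases a)
  have ut: "l \<bullet> u + \<beta> * t < 0"
    using sep(1) c0 by (simp add: a)
  have \<beta>: "\<beta> \<ge> 0"
    using nonneg[of "(0, 1)"] by (simp add: G_def a)
  have dual: "0 \<le> (transpose W *v l) $ i + \<beta> * q $ i" for i
  proof -
    have "l \<bullet> (W *v axis i 1) = (transpose W *v l) \<bullet> axis i 1"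
      by (simp add: dot_lmul_matrix flip: vector_transpose_matrix)
    then show ?thesis
      using nonneg[of "(W *v axis i 1, q $ i)"] by (simp add: G_def a inner_axis)
  qed
  show ?thesis
  proof (cases "\<beta> = 0")
    case False
    with \<beta> have \<beta>: "\<beta> > 0" by simp
    \<comment> \<open>The non-vertical case: dividing by \<beta> turns the inequalities on the
      generators into dual feasibility.\<close>
    define v where "v = - (1 / \<beta>) *\<^sub>R l"
    have "(transpose W *v v) $ i \<le> q $ i" for i
      using dual[of i] \<beta> by (simp add: v_def matrix_vector_mult_scaleR field_simps 
        flip: scaleR_minus_left)
    then have "v \<in> dual_feasible W q" by (simp add: dual_feasible_def less_eq_vec_def)
    moreover have "t < v \<bullet> u" using ut \<beta> by (simp add: v_def field_simps)
    ultimately show ?thesis by blast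
  next
    case True
    obtain v0 where v0: "v0 \<in> dual_feasible W q" using assms by blast
    have lu: "l \<bullet> u < 0" using ut True by simp
    \<comment> \<open>In the vertical case, \<open>- l\<close> is a recession direction of the dual
      feasible set along which the value at \<open>u\<close> increases. The step length is chosen to
      raise this value by \<open>\<bar>t - v0 \<bullet> u\<bar> + 1\<close>.\<close>
    define \<tau> where "\<tau> = (\<bar>t - v0 \<bullet> u\<bar> + 1) / (- (l \<bullet> u))"
    have \<tau>: "\<tau> \<ge> 0" unfolding \<tau>_def using lu by (intro divide_nonneg_pos) auto
    define v where "v = v0 - \<tau> *\<^sub>R l"
    have "(transpose W *v v) $ i \<le> q $ i" for i
    proof -
      have "0 \<le> \<tau> * (transpose W *v l) $ i" using dual[of i] True \<tau> by simp
      then show ?thesis using v0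
        by (auto simp: v_def dual_feasible_def less_eq_vec_def matrix_vector_mult_diff_distrib
            matrix_vector_mult_scaleR add_increasing2 intro: order_trans[rotated])
    qed
    then have "v \<in> dual_feasible W q" by (simp add: dual_feasible_def less_eq_vec_def)
    moreover have "v \<bullet> u = v0 \<bullet> u + (\<bar>t - v0 \<bullet> u\<bar> + 1)"
      using lu by (simp add: v_def \<tau>_def inner_diff_left inner_add_left)
    then have "t < v \<bullet> u" by linarith
    ultimately show ?thesis by blast
  qed
qed

text \<open>A duality gap would contain a real number \<open>t\<close> strictly inside, and the
  certificate for this \<open>t\<close> contradicts the choice. This also covers infeasible
  programs, whose value is infinite on both sides.\<close>

lemma recourse_dual:
  assumes "dual_feasible W q \<noteq> {}"
  shows "recourse W q x z = (SUP v\<in>dual_feasible W q. ereal (v \<bullet> (snd z - fst z *v x)))"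
    (is "_ = ?S")
proof (rule antisym)
  show "?S \<le> recourse W q x z"
    by (intro SUP_least recourse_weak_duality)
  show "recourse W q x z \<le> ?S"
  proof (rule ccontr)
    assume "\<not> recourse W q x z \<le> ?S"
    then obtain t where t: "?S < ereal t" "ereal t < recourse W q x z"
      using ereal_dense2 by (meson not_le)
    have "t < q \<bullet> y" if "0 \<le> y" "W *v y = snd z - fst z *v x" for y
    proof -
      have "recourse W q x z \<le> ereal (q \<bullet> y)"
        unfolding recourse_def using that by (intro INF_lower) simp
      with t(2) show ?thesis using less_le_trans by fastforce
    qed
    from dual_certificate[OF assms this]
    obtain v where "v \<in> dual_feasible W q" "t < v \<bullet> (snd z - fst z *v x)" by blast
    then have "ereal t < ?S" by (auto simp: less_SUP_iff)
    with t(1) show False by simp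
  qed
qed

section \<open>Costs of partitions\<close>

abbreviation dual_value ::
    "real^'n \<Rightarrow> real^'l \<Rightarrow> (real^'n^'l) \<times> (real^'l) \<Rightarrow> real" where
  "dual_value x v z \<equiv> v \<bullet> (snd z - fst z *v x)"

text \<open>By duality, the contribution of a cell to the cost of a partition is a supremum of integrals
  over the cell, also when the cell is negligible.\<close>

definition cell_recourse ::
    "'a measure \<Rightarrow> ('a \<Rightarrow> (real^'n^'l) \<times> (real^'l)) \<Rightarrow> real^'m^'l \<Rightarrow> real^'m
      \<Rightarrow> real^'n \<Rightarrow> ((real^'n^'l) \<times> (real^'l)) set \<Rightarrow> ereal" where
  "cell_recourse M \<xi> W q x S =
     (SUP v\<in>dual_feasible W q. ereal (LINT \<omega>:(\<xi> -` S \<inter> space M)|M. dual_value x v (\<xi> \<omega>)))"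

lemma bounded_linear_dual_value: "bounded_linear (dual_value x v)"
proof -
  have "linear (\<lambda>z. dual_value x v z)"
    by (rule linearI) (auto simp: matrix_vector_mult_add_rdistrib inner_diff_right inner_add_right
        scaleR_matrix_vector_assoc[symmetric] algebra_simps)
  then show ?thesis by (simp add: linear_conv_bounded_linear)
qed

lemma dual_value_scaleR: "dual_value x v (a *\<^sub>R z) = a * dual_value x v z"
  by (simp add: inner_diff_right right_diff_distrib flip: scaleR_matrix_vector_assoc)

context
  fixes M :: "'a measure" and \<xi> :: "'a \<Rightarrow> (real^'n^'l) \<times> (real^'l)"
    and W :: "real^'m^'l" and q :: "real^'m"
  assumes prob: "prob_space M" and int: "integrable M \<xi>" and dual: "dual_feasible W q \<noteq> {}"
begin

interpretation prob_space M by (fact prob)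

lemma measurable_scenario [measurable]: "\<xi> \<in> borel_measurable M"
  using int by simp

lemma integrable_dual_value: "integrable M (\<lambda>\<omega>. dual_value x v (\<xi> \<omega>))"
  using integrable_bounded_linear[OF bounded_linear_dual_value int] .

lemma vimage_sets: "S \<in> sets borel \<Longrightarrow> \<xi> -` S \<inter> space M \<in> sets M"
  by (rule measurable_sets[OF measurable_scenario])

lemma set_integrable_dual_value:
  "A \<in> sets M \<Longrightarrow> set_integrable M A (\<lambda>\<omega>. dual_value x v (\<xi> \<omega>))"
  using integrable_dual_value unfolding set_integrable_def by (rule integrable_mult_indicator[rotated])

lemma set_integral_dual_value:
  assumes "A \<in> sets M"
  shows "(LINT \<omega>:A|M. dual_value x v (\<xi> \<omega>)) = dual_value x v (LINT \<omega>:A|M. \<xi> \<omega>)"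
proof -
  have "integrable M (\<lambda>\<omega>. indicat_real A \<omega> *\<^sub>R \<xi> \<omega>)"
    using int assms by (rule integrable_mult_indicator[rotated])
  from integral_bounded_linear[OF bounded_linear_dual_value this, of v x] show ?thesis
    unfolding set_lebesgue_integral_def by (simp only: dual_value_scaleR real_scaleR_def)
qed

text \<open>The probability of the cell cancels the denominator of the conditional mean, and dual
  values are linear in the scenario. For a negligible cell all the integrals vanish, which matches
  the convention that the left-hand product is 0.\<close>

lemma cell_recourse_eq:
  assumes S: "S \<in> sets borel"
  shows "ereal (measure (distr M borel \<xi>) S) * recourse W q x (cond_mean M \<xi> S)
     = cell_recourse M \<xi> W q x S"
proof -
  let ?A = "\<xi> -` S \<inter> space M"
  let ?p = "measure (distr M borel \<xi>) S"
  have A: "?A \<in> sets M" by (rule vimage_sets[OF S])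
  have p: "?p = prob ?A" using S by (simp add: measure_distr)
  show ?thesis
  proof (cases "?p = 0")
    case True
    then have "AE \<omega> in M. \<omega> \<notin> ?A"
      using A p by (intro AE_not_in) (simp add: null_sets_def emeasure_eq_measure)
    then have "(LINT \<omega>:?A|M. dual_value x v (\<xi> \<omega>)) = 0" for v
      unfolding set_lebesgue_integral_def
      by (intro integral_eq_zero_AE) (auto elim!: eventually_mono)
    then show ?thesis using True dual by (simp add: cell_recourse_def zero_ereal_def[symmetric])
  next
    case False
    then have p0: "?p > 0" by (simp add: less_le)
    let ?m = "LINT \<omega>:?A|M. \<xi> \<omega>"
    have scale: "?p * dual_value x v (cond_mean M \<xi> S) = dual_value x v ?m" for v
      using p0 unfolding cond_mean_def dual_value_scaleR by simp
    have "ereal ?p * (SUP v\<in>dual_feasible W q. ereal (dual_value x v (cond_mean M \<xi> S)))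
        = (SUP v\<in>dual_feasible W q. ereal (dual_value x v ?m))"
    proof -
      \<comment> \<open>Multiplication by a finite positive factor is monotone and continuous on the
        extended reals, so it commutes with the supremum.\<close>
      have "ereal ?p * (SUP v\<in>dual_feasible W q. ereal (dual_value x v (cond_mean M \<xi> S)))
        = (SUP y\<in>(\<lambda>v. ereal (dual_value x v (cond_mean M \<xi> S))) ` dual_feasible W q. ereal ?p * y)"
      proof (rule continuous_at_Sup_mono)
        show "mono ((*) (ereal ?p))" using p0 by (intro monoI ereal_mult_left_mono) auto
        show "continuous (at_left (Sup ((\<lambda>v. ereal (dual_value x v (cond_mean M \<xi> S))) ` dual_feasible W q))) ((*) (ereal ?p))"
          unfolding continuous_within by (intro tendsto_cmult_ereal tendsto_ident_at) auto
      qed (use dual in auto)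
      then show ?thesis by (simp add: image_image scale)
    qed
    then show ?thesis
      by (simp add: recourse_dual[OF dual] cell_recourse_def set_integral_dual_value[OF A])
  qed
qed

lemma partition_recourse_eq:
  assumes "finite_ae_partition M \<xi> \<P>"
  shows "partition_recourse M \<xi> W q \<P> x = (\<Sum>P\<in>\<P>. cell_recourse M \<xi> W q x P)"
  unfolding partition_recourse_def
  using assms by (intro sum.cong cell_recourse_eq) (auto simp: finite_ae_partition_def)

lemma cell_recourse_null:
  assumes "S \<in> null_sets (distr M borel \<xi>)"
  shows "cell_recourse M \<xi> W q x S = 0"
proof -
  have "measure (distr M borel \<xi>) S = 0" using assms by (simp add: measure_def null_setsD1)
  moreover have "S \<in> sets borel" using assms by (auto dest: null_setsD2)
  ultimately show ?thesis using cell_recourse_eq[of S x] by (simp add: zero_ereal_def[symmetric])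
qed

lemma AE_not_in_null_cell:
  assumes "S \<in> null_sets (distr M borel \<xi>)"
  shows "AE \<omega> in M. \<xi> \<omega> \<notin> S"
  using AE_distrD[OF measurable_scenario AE_not_in[OF assms]] .

text \<open>Overlaps of cells and the uncovered remainder are negligible, so additivity over almost
  disjoint sets applies.\<close>

lemma set_integral_partition:
  fixes f :: "'a \<Rightarrow> real"
  assumes \<P>: "finite_ae_partition M \<xi> \<P>" and S: "S \<in> sets borel" and f: "integrable M f"
  shows "(LINT \<omega>:(\<xi> -` S \<inter> space M)|M. f \<omega>) = (\<Sum>P\<in>\<P>. LINT \<omega>:(\<xi> -` (P \<inter> S) \<inter> space M)|M. f \<omega>)"
proof -
  let ?A = "\<lambda>P. \<xi> -` (P \<inter> S) \<inter> space M"
  have sets: "?A P \<in> sets M" if "P \<in> \<P>" for P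
    using that \<P> S by (intro vimage_sets) (auto simp: finite_ae_partition_def)
  have si: "set_integrable M A f" if "A \<in> sets M" for A
    using f that unfolding set_integrable_def by (rule integrable_mult_indicator[rotated])
  have "AE \<omega> in M. \<omega> \<in> ?A P \<and> \<omega> \<in> ?A R \<longrightarrow> P = R" if "P \<in> \<P>" "R \<in> \<P>" for P R
  proof (cases "P = R")
    case False
    then have "P \<inter> R \<in> null_sets (distr M borel \<xi>)"
      using \<P> that by (auto simp: finite_ae_partition_def)
    from AE_not_in_null_cell[OF this] show ?thesis by eventually_elim auto
  qed simp
  then have "(LINT \<omega>:(\<Union>P\<in>\<P>. ?A P)|M. f \<omega>) = (\<Sum>P\<in>\<P>. LINT \<omega>:?A P|M. f \<omega>)"
    using \<P> sets by (intro set_integral_finite_UN_AE si) (auto simp: finite_ae_partition_def)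
  moreover have "(LINT \<omega>:(\<Union>P\<in>\<P>. ?A P)|M. f \<omega>) = (LINT \<omega>:(\<xi> -` S \<inter> space M)|M. f \<omega>)"
  proof (rule set_integral_cong_set)
    have "UNIV - \<Union>\<P> \<in> null_sets (distr M borel \<xi>)" using \<P> by (simp add: finite_ae_partition_def)
    from AE_not_in_null_cell[OF this]
    show "AE \<omega> in M. (\<omega> \<in> \<xi> -` S \<inter> space M) = (\<omega> \<in> (\<Union>P\<in>\<P>. ?A P))"
      by eventually_elim auto
    have "(\<Union>P\<in>\<P>. ?A P) \<in> sets M"
      using \<P> sets by (intro sets.finite_UN) (auto simp: finite_ae_partition_def)
    then show "set_borel_measurable M (\<Union>P\<in>\<P>. ?A P) f"
      using f unfolding set_borel_measurable_def by simp
    show "set_borel_measurable M (\<xi> -` S \<inter> space M) f"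
      using f vimage_sets[OF S] unfolding set_borel_measurable_def by simp
  qed
  ultimately show ?thesis by simp
qed

text \<open>Two different intersections differ in at least one factor, so their overlap lies inside
  a negligible overlap of one of the two given partitions.\<close>

lemma finite_ae_partition_common_refinement:
  assumes "finite_ae_partition M \<xi> \<P>" "finite_ae_partition M \<xi> \<R>"
  shows "finite_ae_partition M \<xi> (common_refinement \<P> \<R>)"
proof -
  let ?N = "null_sets (distr M borel \<xi>)"
  have eq: "common_refinement \<P> \<R> = (\<lambda>(P, R). P \<inter> R) ` (\<P> \<times> \<R>)"
    by (auto simp: common_refinement_def)
  have sub: "S \<in> ?N" if "T \<in> ?N" "S \<subseteq> T" "S \<in> sets borel" for S T
    by (rule null_sets_subset[OF that(1)]) (use that in simp_all)
  have sets: "P \<in> sets borel" if "P \<in> \<P> \<union> \<R>" for P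
    using that assms by (auto simp: finite_ae_partition_def)
  have "P \<inter> R \<inter> (P' \<inter> R') \<in> ?N"
    if "P \<in> \<P>" "P' \<in> \<P>" "R \<in> \<R>" "R' \<in> \<R>" "P \<inter> R \<noteq> P' \<inter> R'" for P P' R R'
  proof (cases "P = P'")
    case True
    then have "R \<noteq> R'" using that by auto
    then have "R \<inter> R' \<in> ?N" using assms(2) that by (auto simp: finite_ae_partition_def)
    then show ?thesis by (rule sub) (use sets that in auto)
  next
    case False
    then have "P \<inter> P' \<in> ?N" using assms(1) that by (auto simp: finite_ae_partition_def)
    then show ?thesis by (rule sub) (use sets that in auto)
  qed
  then have "\<forall>S\<in>common_refinement \<P> \<R>. \<forall>T\<in>common_refinement \<P> \<R>. S \<noteq> T \<longrightarrow> S \<inter> T \<in> ?N"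
    unfolding common_refinement_def by blast
  moreover have "UNIV - \<Union>(common_refinement \<P> \<R>) \<in> ?N"
  proof -
    have "UNIV - \<Union>(common_refinement \<P> \<R>) = (UNIV - \<Union>\<P>) \<union> (UNIV - \<Union>\<R>)"
      by (auto simp: common_refinement_def)
    then show ?thesis using assms by (auto simp: finite_ae_partition_def)
  qed
  moreover have "finite (common_refinement \<P> \<R>)"
    unfolding eq using assms by (auto simp: finite_ae_partition_def)
  moreover have "common_refinement \<P> \<R> \<subseteq> sets borel"
    using sets by (auto simp: common_refinement_def)
  ultimately show ?thesis
    by (simp add: finite_ae_partition_def)
qed

text \<open>This is Jensen's inequality in dual form: for a fixed dual vector the integral splits
  exactly over the cells, and a supremum of sums is at most the sum of the suprema.\<close>

lemma cell_recourse_subadditive: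
  assumes \<P>: "finite_ae_partition M \<xi> \<P>" and S: "S \<in> sets borel"
  shows "cell_recourse M \<xi> W q x S \<le> (\<Sum>P\<in>\<P>. cell_recourse M \<xi> W q x (P \<inter> S))"
  unfolding cell_recourse_def[of _ _ _ _ _ S]
proof (rule SUP_least)
  fix v assume v: "v \<in> dual_feasible W q"
  have "ereal (LINT \<omega>:(\<xi> -` S \<inter> space M)|M. dual_value x v (\<xi> \<omega>))
      = (\<Sum>P\<in>\<P>. ereal (LINT \<omega>:(\<xi> -` (P \<inter> S) \<inter> space M)|M. dual_value x v (\<xi> \<omega>)))"
    using set_integral_partition[OF \<P> S integrable_dual_value] by simp
  also have "\<dots> \<le> (\<Sum>P\<in>\<P>. cell_recourse M \<xi> W q x (P \<inter> S))"
    unfolding cell_recourse_def using v by (intro sum_mono SUP_upper)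
  finally show "ereal (LINT \<omega>:(\<xi> -` S \<inter> space M)|M. dual_value x v (\<xi> \<omega>))
      \<le> (\<Sum>P\<in>\<P>. cell_recourse M \<xi> W q x (P \<inter> S))" .
qed

text \<open>The refinement is a set, so distinct pairs of cells with the same intersection are
  merged. Such an intersection is negligible and contributes 0, so the double sum counts nothing
  twice.\<close>

lemma partition_recourse_common_refinement:
  assumes "finite_ae_partition M \<xi> \<P>" "finite_ae_partition M \<xi> \<R>"
  shows "partition_recourse M \<xi> W q (common_refinement \<P> \<R>) x
     = (\<Sum>P\<in>\<P>. \<Sum>R\<in>\<R>. cell_recourse M \<xi> W q x (P \<inter> R))"
proof -
  let ?h = "\<lambda>(P, R). P \<inter> R"
  have eq: "common_refinement \<P> \<R> = ?h ` (\<P> \<times> \<R>)"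
    by (auto simp: common_refinement_def)
  have "partition_recourse M \<xi> W q (common_refinement \<P> \<R>) x
      = (\<Sum>S\<in>?h ` (\<P> \<times> \<R>). cell_recourse M \<xi> W q x S)"
    using partition_recourse_eq[OF finite_ae_partition_common_refinement[OF assms]] eq by simp
  also have "\<dots> = (\<Sum>p\<in>\<P> \<times> \<R>. cell_recourse M \<xi> W q x (?h p))"
  proof (rule sum.reindex_nontrivial[unfolded o_def])
    show "finite (\<P> \<times> \<R>)" using assms by (auto simp: finite_ae_partition_def)
    fix p p' assume p: "p \<in> \<P> \<times> \<R>" "p' \<in> \<P> \<times> \<R>" "p \<noteq> p'" "?h p = ?h p'"
    obtain P R P' R' where [simp]: "p = (P, R)" "p' = (P', R')" by (cases p, cases p')
    have "P \<inter> R \<in> null_sets (distr M borel \<xi>)"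
    proof (cases "P = P'")
      case True
      then have "R \<inter> R' \<in> null_sets (distr M borel \<xi>)"
        using p assms(2) by (auto simp: finite_ae_partition_def)
      then show ?thesis
        by (rule null_sets_subset) (use p assms in \<open>auto simp: finite_ae_partition_def\<close>)
    next
      case False
      then have "P \<inter> P' \<in> null_sets (distr M borel \<xi>)"
        using p assms(1) by (auto simp: finite_ae_partition_def)
      then show ?thesis
        by (rule null_sets_subset) (use p assms in \<open>auto simp: finite_ae_partition_def\<close>)
    qed
    then show "cell_recourse M \<xi> W q x (?h p) = 0" by (simp add: cell_recourse_null)
  qed
  also have "\<dots> = (\<Sum>P\<in>\<P>. \<Sum>R\<in>\<R>. cell_recourse M \<xi> W q x (P \<inter> R))"
    by (simp add: sum.cartesian_product split_def)
  finally show ?thesis .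
qed

text \<open>Each cell of one partition is cut by the other, and subadditivity applies cell by cell.
  The second inequality, applied to an adapted partition, is what makes a refined cost exact at an
  iterate.\<close>

lemma partition_recourse_refine:
  assumes "finite_ae_partition M \<xi> \<P>" "finite_ae_partition M \<xi> \<R>"
  shows "partition_recourse M \<xi> W q \<P> x \<le> partition_recourse M \<xi> W q (common_refinement \<P> \<R>) x"
    and "partition_recourse M \<xi> W q \<R> x \<le> partition_recourse M \<xi> W q (common_refinement \<P> \<R>) x"
proof -
  have sets: "S \<in> sets borel" if "S \<in> \<P> \<union> \<R>" for S
    using that assms by (auto simp: finite_ae_partition_def)
  show "partition_recourse M \<xi> W q \<P> x \<le> partition_recourse M \<xi> W q (common_refinement \<P> \<R>) x"
    unfolding partition_recourse_common_refinement[OF assms] partition_recourse_eq[OF assms(1)]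
    using cell_recourse_subadditive[OF assms(2) sets] by (intro sum_mono) (simp add: Int_commute)
  show "partition_recourse M \<xi> W q \<R> x \<le> partition_recourse M \<xi> W q (common_refinement \<P> \<R>) x"
    unfolding partition_recourse_common_refinement[OF assms] partition_recourse_eq[OF assms(2)]
    by (subst sum.swap) (intro sum_mono cell_recourse_subadditive[OF assms(1)], auto simp: sets)
qed

text \<open>Dual values are affine in \<open>x\<close>, so each cell contributes a supremum of
  affine functions. Real upper bounds in the hypotheses keep infinite values out of the convex
  combination.\<close>

lemma partition_recourse_convex:
  assumes \<P>: "finite_ae_partition M \<xi> \<P>" and "0 \<le> \<mu>" "0 \<le> \<nu>" "\<mu> + \<nu> = 1"
    and "partition_recourse M \<xi> W q \<P> x \<le> ereal a" "partition_recourse M \<xi> W q \<P> y \<le> ereal b"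
  shows "partition_recourse M \<xi> W q \<P> (\<mu> *\<^sub>R x + \<nu> *\<^sub>R y) \<le> ereal (\<mu> * a + \<nu> * b)"
proof -
  let ?c = "\<lambda>x. cell_recourse M \<xi> W q x"
  let ?I = "\<lambda>P x v. LINT \<omega>:(\<xi> -` P \<inter> space M)|M. dual_value x v (\<xi> \<omega>)"
  have cell: "?c (\<mu> *\<^sub>R x + \<nu> *\<^sub>R y) P \<le> ?c x P * ereal \<mu> + ?c y P * ereal \<nu>" if "P \<in> \<P>" for P
    unfolding cell_recourse_def[of _ _ _ _ "\<mu> *\<^sub>R x + \<nu> *\<^sub>R y"]
  proof (rule SUP_least)
    fix v assume v: "v \<in> dual_feasible W q"
    have A: "\<xi> -` P \<inter> space M \<in> sets M"
      using that \<P> by (intro vimage_sets) (auto simp: finite_ae_partition_def)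
    have dv: "dual_value (\<mu> *\<^sub>R x + \<nu> *\<^sub>R y) v z = \<mu> * dual_value x v z + \<nu> * dual_value y v z" for z
    proof -
      have "snd z = \<mu> *\<^sub>R snd z + \<nu> *\<^sub>R snd z" using assms(4) by (metis scaleR_add_left scaleR_one)
      then have "snd z - fst z *v (\<mu> *\<^sub>R x + \<nu> *\<^sub>R y)
          = \<mu> *\<^sub>R (snd z - fst z *v x) + \<nu> *\<^sub>R (snd z - fst z *v y)"
        by (simp add: matrix_vector_right_distrib matrix_vector_mult_scaleR scaleR_diff_right)
      then show ?thesis by (simp add: inner_add_right)
    qed
    have "ereal (?I P (\<mu> *\<^sub>R x + \<nu> *\<^sub>R y) v) = ereal (?I P x v) * ereal \<mu> + ereal (?I P y v) * ereal \<nu>"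
      using set_integrable_dual_value[OF A]
      by (simp add: dv set_integral_add set_integrable_mult_right mult.commute)
    also have "\<dots> \<le> ?c x P * ereal \<mu> + ?c y P * ereal \<nu>"
      unfolding cell_recourse_def using assms(2,3) v
      by (intro add_mono ereal_mult_right_mono SUP_upper) auto
    finally show "ereal (?I P (\<mu> *\<^sub>R x + \<nu> *\<^sub>R y) v) \<le> ?c x P * ereal \<mu> + ?c y P * ereal \<nu>" .
  qed
  have "partition_recourse M \<xi> W q \<P> (\<mu> *\<^sub>R x + \<nu> *\<^sub>R y) \<le> (\<Sum>P\<in>\<P>. ?c x P * ereal \<mu> + ?c y P * ereal \<nu>)"
    unfolding partition_recourse_eq[OF \<P>] by (intro sum_mono cell)
  also have "\<dots> = (\<Sum>P\<in>\<P>. ?c x P) * ereal \<mu> + (\<Sum>P\<in>\<P>. ?c y P) * ereal \<nu>"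
  proof -
    \<comment> \<open>Cell values may be infinite; the factor can still be pulled out because it is
      real and nonnegative.\<close>
    have "(\<Sum>P\<in>Q. f P * ereal c) = (\<Sum>P\<in>Q. f P) * ereal c" if "0 \<le> c" for c f and Q :: "((real^'n^'l) \<times> (real^'l)) set set"
      by (induction Q rule: infinite_finite_induct) (auto simp: distrib_left_ereal_nn[OF that])
    then show ?thesis using assms(2,3) by (simp add: sum.distrib)
  qed
  also have "\<dots> \<le> ereal a * ereal \<mu> + ereal b * ereal \<nu>"
    using assms(2,3,5,6) unfolding partition_recourse_eq[OF \<P>]
    by (intro add_mono ereal_mult_right_mono) auto
  finally show ?thesis by (simp add: mult.commute)
qed

section \<open>Comparison of partition costs with the expected recourse cost\<close>

text \<open>By duality the recourse cost is a supremum of continuous functions, hence lower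
  semicontinuous in the scenario. Openness takes care of the possibly uncountable union.\<close>

lemma measurable_recourse: "(\<lambda>\<omega>. recourse W q x (\<xi> \<omega>)) \<in> borel_measurable M"
proof (rule measurable_compose[OF measurable_scenario])
  show "recourse W q x \<in> borel_measurable borel"
  proof (rule borel_measurableI_greater)
    fix t :: ereal
    have "{z \<in> space borel. t < recourse W q x z} = (\<Union>v\<in>dual_feasible W q. {z. t < ereal (dual_value x v z)})"
      by (auto simp: recourse_dual[OF dual] less_SUP_iff)
    moreover have "open (\<Union>v\<in>dual_feasible W q. {z. t < ereal (dual_value x v z)})"
      by (intro open_UN ballI open_Collect_less continuous_intros
          linear_continuous_on[OF bounded_linear_dual_value])
    ultimately show "{z \<in> space borel. t < recourse W q x z} \<in> sets borel"
      by (simp only: borel_open)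
  qed
qed

text \<open>A fixed dual feasible vector gives an integrable minorant, so the negative part has
  finite integral. Finiteness of the expectation then bounds the positive part, and the recourse
  cost is almost surely real.\<close>

lemma integral_recourse:
  assumes fin: "exp_recourse M \<xi> W q x < \<infinity>"
  obtains g where "integrable M g" "AE \<omega> in M. recourse W q x (\<xi> \<omega>) = ereal (g \<omega>)"
    "exp_recourse M \<xi> W q x = ereal (LINT \<omega>|M. g \<omega>)"
proof -
  let ?Q = "\<lambda>\<omega>. recourse W q x (\<xi> \<omega>)"
  note [measurable] = measurable_recourse
  obtain v where v: "v \<in> dual_feasible W q" using dual by blast
  let ?l = "\<lambda>\<omega>. dual_value x v (\<xi> \<omega>)"
  have lower: "ereal (?l \<omega>) \<le> ?Q \<omega>" for \<omega> using recourse_weak_duality[OF v] .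
  have "(\<integral>\<^sup>+\<omega>. e2ennreal (- ?Q \<omega>) \<partial>M) \<le> (\<integral>\<^sup>+\<omega>. ennreal (norm (?l \<omega>)) \<partial>M)"
  proof (rule nn_integral_mono)
    fix \<omega>
    have "- ?Q \<omega> \<le> ereal (norm (?l \<omega>))"
      using lower[of \<omega>] by (cases "?Q \<omega>") auto
    then show "e2ennreal (- ?Q \<omega>) \<le> ennreal (norm (?l \<omega>))"
      by (metis e2ennreal_ereal e2ennreal_mono)
  qed
  also have "\<dots> < \<infinity>" using integrable_dual_value[of v x] by (simp add: integrable_iff_bounded)
  finally have neg: "(\<integral>\<^sup>+\<omega>. e2ennreal (- ?Q \<omega>) \<partial>M) \<noteq> \<infinity>" by simp
  have pos: "(\<integral>\<^sup>+\<omega>. e2ennreal (?Q \<omega>) \<partial>M) \<noteq> \<infinity>"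
    using fin neg unfolding exp_recourse_def ereal_expectation_def
    by (cases "\<integral>\<^sup>+\<omega>. e2ennreal (- ?Q \<omega>) \<partial>M") auto
  define g where "g \<omega> = real_of_ereal (?Q \<omega>)" for \<omega>
  have [measurable]: "g \<in> borel_measurable M" unfolding g_def by measurable
  have "AE \<omega> in M. e2ennreal (?Q \<omega>) \<noteq> \<infinity>"
    using pos by (intro nn_integral_PInf_AE) auto
  then have Qg: "AE \<omega> in M. ?Q \<omega> = ereal (g \<omega>)"
  proof eventually_elim
    fix \<omega> assume "e2ennreal (?Q \<omega>) \<noteq> \<infinity>"
    then show "?Q \<omega> = ereal (g \<omega>)" using lower[of \<omega>] by (cases "?Q \<omega>") (auto simp: g_def)
  qed
  have pos': "(\<integral>\<^sup>+\<omega>. ennreal (g \<omega>) \<partial>M) = (\<integral>\<^sup>+\<omega>. e2ennreal (?Q \<omega>) \<partial>M)"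
    using Qg by (intro nn_integral_cong_AE) (auto elim!: eventually_mono)
  have neg': "(\<integral>\<^sup>+\<omega>. ennreal (- g \<omega>) \<partial>M) = (\<integral>\<^sup>+\<omega>. e2ennreal (- ?Q \<omega>) \<partial>M)"
    using Qg by (intro nn_integral_cong_AE) (auto elim!: eventually_mono)
  have int_g: "integrable M g"
    unfolding real_integrable_def using pos pos' neg neg' by simp
  have "exp_recourse M \<xi> W q x = ereal (LINT \<omega>|M. g \<omega>)"
    unfolding real_lebesgue_integral_def[OF int_g] exp_recourse_def ereal_expectation_def pos' neg'
    using pos neg
    by (cases "\<integral>\<^sup>+\<omega>. e2ennreal (- ?Q \<omega>) \<partial>M"; cases "\<integral>\<^sup>+\<omega>. e2ennreal (?Q \<omega>) \<partial>M") auto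
  with int_g Qg show thesis using that by blast
qed

text \<open>Weak duality bounds each dual value pointwise by the recourse cost, so each cell
  contributes at most the integral of that cost over the cell.\<close>

lemma partition_recourse_le:
  assumes \<P>: "finite_ae_partition M \<xi> \<P>"
  shows "partition_recourse M \<xi> W q \<P> x \<le> exp_recourse M \<xi> W q x"
proof (cases "exp_recourse M \<xi> W q x < \<infinity>")
  case True
  then obtain g where g: "integrable M g" "AE \<omega> in M. recourse W q x (\<xi> \<omega>) = ereal (g \<omega>)"
    and eq: "exp_recourse M \<xi> W q x = ereal (LINT \<omega>|M. g \<omega>)" by (rule integral_recourse)
  have "cell_recourse M \<xi> W q x P \<le> ereal (LINT \<omega>:(\<xi> -` P \<inter> space M)|M. g \<omega>)" if "P \<in> \<P>" for P
    unfolding cell_recourse_def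
  proof (intro SUP_least, unfold ereal_less_eq, rule set_integral_mono_AE)
    fix v assume v: "v \<in> dual_feasible W q"
    have A: "\<xi> -` P \<inter> space M \<in> sets M"
      using that \<P> by (intro vimage_sets) (auto simp: finite_ae_partition_def)
    show "set_integrable M (\<xi> -` P \<inter> space M) (\<lambda>\<omega>. dual_value x v (\<xi> \<omega>))"
      by (rule set_integrable_dual_value[OF A])
    show "set_integrable M (\<xi> -` P \<inter> space M) g"
      using g(1) A unfolding set_integrable_def by (rule integrable_mult_indicator[rotated])
    show "AE \<omega> in M. \<omega> \<in> \<xi> -` P \<inter> space M \<longrightarrow> dual_value x v (\<xi> \<omega>) \<le> g \<omega>"
      using g(2) by eventually_elim (use recourse_weak_duality[OF v] in \<open>metis ereal_less_eq(3)\<close>)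
  qed
  then have "partition_recourse M \<xi> W q \<P> x \<le> (\<Sum>P\<in>\<P>. ereal (LINT \<omega>:(\<xi> -` P \<inter> space M)|M. g \<omega>))"
    unfolding partition_recourse_eq[OF \<P>] by (intro sum_mono)
  also have "\<dots> = ereal (\<Sum>P\<in>\<P>. LINT \<omega>:(\<xi> -` (P \<inter> UNIV) \<inter> space M)|M. g \<omega>)" by simp
  also have "\<dots> = ereal (LINT \<omega>|M. g \<omega>)"
    using set_integral_partition[OF \<P> _ g(1), of UNIV] set_integral_space[OF g(1)] by simp
  finally show ?thesis unfolding eq .
qed simp

end

section \<open>Packing bounds\<close>

text \<open>Volume comparison of disjoint balls of radius \<open>\<rho> / 2\<close> with one ball of
  radius \<open>D + \<rho> / 2\<close>. To work with Lebesgue measure on the full space, the balls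
  are thickened in the coordinates outside \<open>I\<close>.\<close>

lemma packing_coordinate_subspace:
  fixes P :: "(real^'n) set"
  assumes "finite P" and supp: "\<And>x i. x \<in> P \<Longrightarrow> i \<notin> I \<Longrightarrow> x $ i = 0"
    and "0 < \<rho>" and D: "0 \<le> D" and sep: "\<And>x y. x \<in> P \<Longrightarrow> y \<in> P \<Longrightarrow> x \<noteq> y \<Longrightarrow> \<rho> < dist x y"
    and diam: "\<And>x y. x \<in> P \<Longrightarrow> y \<in> P \<Longrightarrow> dist x y \<le> D"
  shows "real (card P) \<le> (1 + 2 * D / \<rho>) ^ card I"
proof (cases "P = {}")
  case True
  then show ?thesis using D \<open>0 < \<rho>\<close> by simp
next
  case False
  then obtain p where p: "p \<in> P" by blast
  define res where "res v = (\<chi> i. if i \<in> I then v $ i else 0)" for v :: "real^'n"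
  \<comment> \<open>A ball of radius \<open>t\<close> in the coordinates of \<open>I\<close>, times
    a fixed open cube in the others. Its volume is therefore proportional to
    \<open>t ^ card I\<close>.\<close>
  define K where "K t = {v :: real^'n. norm (res v) < t \<and> (\<forall>i. i \<notin> I \<longrightarrow> \<bar>v $ i\<bar> < 1)}" for t
  have res_add: "res (v + w) = res v + res w" "res (v - w) = res v - res w" for v w
    by (auto simp: res_def vec_eq_iff)
  have res_P: "res v = v" if "v \<in> P" for v
    using supp[OF that] by (auto simp: res_def vec_eq_iff)
  have "linear res"
    by (rule linearI) (auto simp: res_def vec_eq_iff)
  then have cont: "continuous_on UNIV res"
    by (simp add: linear_continuous_on linear_conv_bounded_linear)
  have open_K: "open (K t)" for t
  proof -
    have "K t = {v. norm (res v) < t} \<inter> (\<Inter>i\<in>- I. {v. \<bar>v $ i\<bar> < 1})"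
      by (auto simp: K_def)
    moreover have "open {v. norm (res v) < t}"
      by (intro open_Collect_less continuous_intros cont)
    moreover have "open (\<Inter>i\<in>- I. {v. \<bar>v $ i\<bar> < (1::real)})"
      by (intro open_INT ballI open_Collect_less continuous_intros) auto
    ultimately show ?thesis by auto
  qed
  have bounded_K: "bounded (K t)" for t
  proof (rule boundedI)
    fix v assume v: "v \<in> K t"
    have "norm v \<le> norm (res v) + norm (v - res v)" by (metis add.commute diff_add_cancel norm_triangle_ineq)
    also have "norm (v - res v) \<le> (\<Sum>i\<in>UNIV. \<bar>(v - res v) $ i\<bar>)" by (rule norm_le_l1_cart)
    also have "\<dots> \<le> (\<Sum>i\<in>(UNIV::'n set). 1)"
      using v by (intro sum_mono) (auto simp: K_def res_def less_imp_le)
    finally show "norm v \<le> t + real CARD('n)" using v by (auto simp: K_def)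
  qed
  have meas_K: "K t \<in> lmeasurable" for t
    using open_K bounded_K by (simp add: lmeasurable_open)
  have scale: "measure lebesgue (K t) = t ^ card I * measure lebesgue (K 1)" if "t > 0" for t
  proof -
    let ?m = "\<lambda>i. if i \<in> I then t else 1"
    let ?f = "\<lambda>v. \<chi> k. ?m k * v $ k"
    have res_f: "res (?f v) = t *\<^sub>R res v" for v by (auto simp: res_def vec_eq_iff)
    have f_inv: "?f (\<chi> k. v $ k / ?m k) = v" for v using that by (auto simp: vec_eq_iff)
    have "?f ` K 1 = K t"
    proof (intro equalityI subsetI)
      fix v assume "v \<in> ?f ` K 1"
      then show "v \<in> K t" using that by (auto simp: K_def res_f)
    next
      fix v assume v: "v \<in> K t"
      have "t *\<^sub>R res (\<chi> k. v $ k / ?m k) = res v" by (metis f_inv res_f)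
      then have "t * norm (res (\<chi> k. v $ k / ?m k)) = norm (res v)"
        using that by (metis abs_of_pos norm_scaleR)
      then have "t * norm (res (\<chi> k. v $ k / ?m k)) < t * 1" using v by (auto simp: K_def)
      then have "norm (res (\<chi> k. v $ k / ?m k)) < 1"
        using that by (simp only: mult_less_cancel_left_pos)
      then have "(\<chi> k. v $ k / ?m k) \<in> K 1" using v by (auto simp: K_def)
      with f_inv[of v] show "v \<in> ?f ` K 1" by (intro image_eqI[where x = "\<chi> k. v $ k / ?m k"]) simp_all
    qed
    moreover have "measure lebesgue (?f ` K 1) = \<bar>prod ?m UNIV\<bar> * measure lebesgue (K 1)"
      using measure_stretch[OF meas_K] .
    moreover have "prod ?m UNIV = t ^ card I" by (simp add: prod.If_cases)
    ultimately show ?thesis using that by simp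
  qed
  have pos: "measure lebesgue (K 1) > 0"
  proof -
    have "res 0 = 0" by (simp add: res_def vec_eq_iff)
    then have "0 \<in> K 1" by (simp add: K_def)
    then have "\<not> negligible (K 1)" using open_K open_not_negligible by blast
    then show ?thesis using meas_K by (simp add: negligible_iff_measure zero_less_measure_iff)
  qed
  \<comment> \<open>A common point of two translates would put their centres at distance less than
    \<rho>. All translates lie in the copy of \<open>K (D + \<rho> / 2)\<close> around
    \<open>p\<close>.\<close>
  let ?B = "\<lambda>x. (+) x ` K (\<rho> / 2)"
  have "real (card P) * measure lebesgue (K (\<rho> / 2)) = (\<Sum>x\<in>P. measure lebesgue (?B x))"
    by (simp add: measure_translation)
  also have "\<dots> = measure lebesgue (\<Union>x\<in>P. ?B x)"
  proof (rule measure_UNION_AE[symmetric])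
    show "pairwise (\<lambda>x y. AE v in lebesgue. v \<notin> ?B x \<or> v \<notin> ?B y) P"
    proof (intro pairwiseI AE_I2)
      fix x y u assume xy: "x \<in> P" "y \<in> P" "x \<noteq> y"
      show "u \<notin> ?B x \<or> u \<notin> ?B y"
      proof (rule ccontr)
        assume "\<not> ?thesis"
        then obtain v w where v: "v \<in> K (\<rho> / 2)" and w: "w \<in> K (\<rho> / 2)" and "x + v = y + w" by auto
        then have "x - y = w - v" by (simp add: algebra_simps)
        then have "x - y = res w - res v" using res_P xy by (metis res_add(2))
        then have "norm (x - y) \<le> norm (res w) + norm (res v)" by (simp add: norm_triangle_ineq4)
        also have "\<dots> < \<rho>" using v w by (auto simp: K_def)
        finally show False using sep[OF xy] by (simp add: dist_norm)
      qed
    qed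
  qed (auto intro!: measurable_translation meas_K assms)
  also have "\<dots> \<le> measure lebesgue ((+) p ` K (D + \<rho> / 2))"
  proof (rule measure_mono_fmeasurable)
    show "(\<Union>x\<in>P. ?B x) \<subseteq> (+) p ` K (D + \<rho> / 2)"
    proof clarify
      fix x v assume x: "x \<in> P" and v: "v \<in> K (\<rho> / 2)"
      have "norm (res ((x - p) + v)) \<le> norm (x - p) + norm (res v)"
        using x p by (simp add: res_add res_P norm_triangle_ineq)
      also have "\<dots> < D + \<rho> / 2" using diam[OF x p] v by (auto simp: K_def dist_norm)
      finally have "(x - p) + v \<in> K (D + \<rho> / 2)" using v supp[OF x] supp[OF p] by (auto simp: K_def)
      then show "x + v \<in> (+) p ` K (D + \<rho> / 2)" by (force simp: algebra_simps)
    qed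
  qed (auto intro!: measurable_translation meas_K fmeasurableD fmeasurable.finite_UN assms)
  also have "\<dots> = (D + \<rho> / 2) ^ card I * measure lebesgue (K 1)"
    using D \<open>0 < \<rho>\<close> by (simp add: measure_translation scale[of "D + \<rho> / 2"])
  finally have "real (card P) * (\<rho> / 2) ^ card I \<le> (D + \<rho> / 2) ^ card I"
    using pos \<open>0 < \<rho>\<close> by (simp add: scale[of "\<rho> / 2"])
  then have "real (card P) \<le> (D + \<rho> / 2) ^ card I / (\<rho> / 2) ^ card I"
    using \<open>0 < \<rho>\<close> by (intro mult_imp_le_div_pos) auto
  then have "real (card P) \<le> ((D + \<rho> / 2) / (\<rho> / 2)) ^ card I"
    by (simp only: power_divide)
  also have "(D + \<rho> / 2) / (\<rho> / 2) = 1 + 2 * D / \<rho>" using \<open>0 < \<rho>\<close> by (simp add: field_simps)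
  finally show ?thesis .
qed

text \<open>Cutting the line into half-open intervals of length \<rho> from the minimum on, each
  interval holds at most one point. This saves the factor 2 of the volume argument.\<close>

lemma card_separated_reals:
  fixes A :: "real set"
  assumes "finite A" "0 < \<rho>" "0 \<le> D"
    and sep: "\<And>s t. s \<in> A \<Longrightarrow> t \<in> A \<Longrightarrow> s \<noteq> t \<Longrightarrow> \<rho> < \<bar>s - t\<bar>"
    and diam: "\<And>s t. s \<in> A \<Longrightarrow> t \<in> A \<Longrightarrow> \<bar>s - t\<bar> \<le> D"
  shows "real (card A) \<le> 1 + D / \<rho>"
proof (cases "A = {}")
  case True
  then show ?thesis using assms(2,3) by simp
next
  case False
  define m where "m = Min A"
  have m: "m \<in> A" "\<And>t. t \<in> A \<Longrightarrow> m \<le> t" using \<open>finite A\<close> False by (auto simp: m_def)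
  define f where "f t = \<lfloor>(t - m) / \<rho>\<rfloor>" for t
  have "inj_on f A"
  proof (rule inj_onI, rule ccontr)
    fix s t assume st: "s \<in> A" "t \<in> A" "f s = f t" "s \<noteq> t"
    have "\<bar>(s - m) / \<rho> - (t - m) / \<rho>\<bar> < 1" using st(3) unfolding f_def by linarith
    also have "(s - m) / \<rho> - (t - m) / \<rho> = (s - t) / \<rho>" by (simp add: diff_divide_distrib)
    finally show False using sep[OF st(1,2,4)] \<open>0 < \<rho>\<close> by (simp add: field_simps)
  qed
  moreover have "f ` A \<subseteq> {0..\<lfloor>D / \<rho>\<rfloor>}"
  proof clarify
    fix t assume t: "t \<in> A"
    have "0 \<le> (t - m) / \<rho>" "(t - m) / \<rho> \<le> D / \<rho>"
      using m(2)[OF t] diam[OF t m(1)] \<open>0 < \<rho>\<close> by (auto intro!: divide_right_mono)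
    then show "f t \<in> {0..\<lfloor>D / \<rho>\<rfloor>}" unfolding f_def by (auto intro: floor_mono)
  qed
  ultimately have "card A \<le> card {0..\<lfloor>D / \<rho>\<rfloor>}"
    by (intro card_inj_on_le) auto
  also have "real \<dots> = of_int \<lfloor>D / \<rho>\<rfloor> + 1" using assms(2,3) by simp
  finally show ?thesis using of_int_floor_le[of "D / \<rho>"] by linarith
qed

text \<open>After a translation, a linear isometry carries \<open>U\<close> onto a coordinate
  subspace of the same dimension, where the previous bounds apply.\<close>

lemma packing_subspace:
  fixes P :: "(real^'n) set"
  assumes "finite P" "subspace U" and PU: "\<And>x y. x \<in> P \<Longrightarrow> y \<in> P \<Longrightarrow> x - y \<in> U"
    and \<rho>: "0 < \<rho>" and D: "0 \<le> D"
    and sep: "\<And>x y. x \<in> P \<Longrightarrow> y \<in> P \<Longrightarrow> x \<noteq> y \<Longrightarrow> \<rho> < dist x y"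
    and diam: "\<And>x y. x \<in> P \<Longrightarrow> y \<in> P \<Longrightarrow> dist x y \<le> D"
  shows "real (card P) \<le> (1 + 2 * D / \<rho>) ^ dim U"
    and "dim U \<le> 1 \<Longrightarrow> real (card P) \<le> 1 + D / \<rho>"
proof -
  obtain I :: "'n set" where I: "card I = dim U"
    by (metis DIM_cart DIM_real dim_subset_UNIV mult.right_neutral obtain_subset_with_card_n)
  define T where "T = {x :: real^'n. \<forall>i. i \<notin> I \<longrightarrow> x $ i = 0}"
  have "subspace T" by (simp add: T_def subspace_def)
  moreover have "dim T = card I"
    unfolding T_def dim_vec_eq[symmetric] by (rule dim_substandard_cart)
  ultimately obtain f where f: "linear f" "f ` U = T" "\<And>x. x \<in> U \<Longrightarrow> norm (f x) = norm x"
    using isometry_subspaces[OF \<open>subspace U\<close>] I by metis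
  have dist_f: "dist (f (x - p)) (f (y - p)) = dist x y" if "x \<in> P" "y \<in> P" for x y p
    using f(3)[OF PU[OF that]] by (simp add: dist_norm linear_diff[OF f(1)])
  have "\<exists>P' :: (real^'n) set. finite P' \<and> card P' = card P \<and> P' \<subseteq> T
      \<and> (\<forall>x\<in>P'. \<forall>y\<in>P'. (x \<noteq> y \<longrightarrow> \<rho> < dist x y) \<and> dist x y \<le> D)"
  proof (cases "P = {}")
    case True
    then show ?thesis by (intro exI[of _ "{}"]) auto
  next
    case False
    then obtain p where p: "p \<in> P" by blast
    let ?g = "\<lambda>x. f (x - p)"
    have "inj_on ?g P" by (rule inj_onI) (use dist_f in \<open>metis dist_eq_0_iff\<close>)
    then have "card (?g ` P) = card P" by (rule card_image)
    moreover have "?g ` P \<subseteq> T" using PU p f(2) by blast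
    moreover have "\<forall>x\<in>?g ` P. \<forall>y\<in>?g ` P. (x \<noteq> y \<longrightarrow> \<rho> < dist x y) \<and> dist x y \<le> D"
      using sep diam by (auto simp: dist_f)
    ultimately show ?thesis using \<open>finite P\<close> by (intro exI[of _ "?g ` P"]) auto
  qed
  then obtain P' :: "(real^'n) set" where P': "finite P'" "card P' = card P" "P' \<subseteq> T"
    "\<And>x y. x \<in> P' \<Longrightarrow> y \<in> P' \<Longrightarrow> x \<noteq> y \<Longrightarrow> \<rho> < dist x y"
    "\<And>x y. x \<in> P' \<Longrightarrow> y \<in> P' \<Longrightarrow> dist x y \<le> D"
    by blast
  show "real (card P) \<le> (1 + 2 * D / \<rho>) ^ dim U"
    using packing_coordinate_subspace[OF P'(1) _ \<rho> D P'(4,5), of I] P'(2,3) I by (auto simp: T_def)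
  assume "dim U \<le> 1"
  then obtain i where i: "I \<subseteq> {i}"
    using I card_le_Suc0_iff_eq[of I] by (cases "I = {}") auto
  have coord: "dist x y = \<bar>x $ i - y $ i\<bar>" if "x \<in> P'" "y \<in> P'" for x y
  proof -
    have "z $ k = 0" if "z \<in> P'" "k \<noteq> i" for z k
      using that P'(3) i by (auto simp: T_def)
    then have "x - y = (x $ i - y $ i) *\<^sub>R axis i 1"
      using that by (auto simp: vec_eq_iff axis_def)
    then show ?thesis by (simp add: dist_norm)
  qed
  have inj: "inj_on (\<lambda>x. x $ i) P'" by (rule inj_onI) (use coord in force)
  have "real (card ((\<lambda>x. x $ i) ` P')) \<le> 1 + D / \<rho>"
    using P'(1,4,5) coord by (intro card_separated_reals \<rho> D) auto
  then show "real (card P) \<le> 1 + D / \<rho>" using card_image[OF inj] P'(2) by simp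
qed

section \<open>Summing the packing bounds over all supports\<close>

text \<open>The better value for \<open>d = 2\<close> is needed: with \<open>1 + 2 r\<close> instead, the bound
  \<open>sum_face_bound_le\<close> below fails for \<open>n = 3\<close> and \<open>n = 4\<close> when \<open>r\<close> is close to 1.\<close>

definition face_bound :: "real \<Rightarrow> nat \<Rightarrow> real" where
  "face_bound r d = (if d = 2 then 1 + r else (1 + 2 * r) ^ (d - 1))"

text \<open>Up to a slack of 1, this is what the case \<open>r = 1\<close> of the next estimate
  needs when \<open>face_bound\<close> is relaxed to \<open>(1 + 2 * r) ^ (d - 1)\<close>. For small
  \<open>n\<close>, rational lower bounds of the square root suffice.\<close>

lemma sqrt_power_bound:
  assumes "5 \<le> n"
  shows "4 ^ n + 3 \<le> 3 * (sqrt (real n) + 1) ^ n"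
proof (cases "n \<ge> 9")
  case True
  have "(2 :: real) ^ 2 \<le> 2 ^ (2 * n)" using True by (intro power_increasing) auto
  then have "(3 :: real) \<le> 2 * 4 ^ n" by (simp add: power_mult)
  moreover have "3 \<le> sqrt (real n)" using True by (intro real_le_rsqrt) auto
  then have "(4 :: real) ^ n \<le> (sqrt (real n) + 1) ^ n" by (intro power_mono) auto
  ultimately show ?thesis by linarith
next
  case False
  have step: ?thesis if "4 ^ n + 3 \<le> 3 * (a + 1) ^ n" "0 \<le> a" "a\<^sup>2 \<le> real n" for a
  proof -
    have "a \<le> sqrt (real n)" using that by (intro real_le_rsqrt)
    then have "(a + 1) ^ n \<le> (sqrt (real n) + 1) ^ n" using that by (intro power_mono) auto
    with that show ?thesis by linarith
  qed
  consider "n = 5" | "n = 6" | "n = 7" | "n = 8" using assms False by linarith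
  then show ?thesis
  proof cases
    case 1 then show ?thesis by (intro step[of "223 / 100"]) (simp_all add: power_divide)
  next
    case 2 then show ?thesis by (intro step[of "24 / 10"]) (simp_all add: power_divide)
  next
    case 3 then show ?thesis by (intro step[of "26 / 10"]) (simp_all add: power_divide)
  next
    case 4 then show ?thesis by (intro step[of "28 / 10"]) (simp_all add: power_divide)
  qed
qed

text \<open>For \<open>n \<ge> 5\<close> the binomial theorem evaluates a relaxed sum, and the
  comparison reduces to \<open>r = 1\<close>. For smaller \<open>n\<close> both sides are expanded
  in powers of \<open>r - 1\<close>, with a rational lower bound for the square root; the difference
  has nonnegative coefficients.\<close>

lemma sum_face_bound_le:
  assumes n: "1 \<le> n" and r: "1 < r"
  shows "1 + (\<Sum>d=1..n. real (n choose d) * face_bound r d) \<le> (sqrt (real n) * r + 1) ^ n"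
proof (cases "n \<ge> 5")
  case True
  define c where "c = sqrt (real n)"
  define B where "B = (c + 1) ^ n"
  define E where "E = (c * r + 1) ^ n"
  have c: "1 \<le> c" using n by (simp add: c_def)
  have B: "1 \<le> B" using c by (simp add: B_def)
  have "c * 1 \<le> c * r" using c r by (intro mult_left_mono) auto
  then have E: "B \<le> E" unfolding B_def E_def using c by (intro power_mono) auto
  \<comment> \<open>The factor \<open>1 + 2 * r\<close> raises the exponent \<open>d - 1\<close> to
    \<open>d\<close>, giving a binomial sum without its term for \<open>d = 0\<close>.\<close>
  have "(1 + 2 * r) * (\<Sum>d=1..n. real (n choose d) * face_bound r d)
      \<le> (\<Sum>d=1..n. real (n choose d) * (1 + 2 * r) ^ d)"
    unfolding sum_distrib_left
  proof (rule sum_mono)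
    fix d assume "d \<in> {1..n}"
    then have d: "(1 + 2 * r) ^ d = (1 + 2 * r) * (1 + 2 * r) ^ (d - 1)"
      by (cases d) auto
    have "face_bound r d \<le> (1 + 2 * r) ^ (d - 1)" using r by (simp add: face_bound_def)
    then have "(1 + 2 * r) * (real (n choose d) * face_bound r d)
        \<le> (1 + 2 * r) * (real (n choose d) * (1 + 2 * r) ^ (d - 1))"
      using r by (intro mult_left_mono) auto
    then show "(1 + 2 * r) * (real (n choose d) * face_bound r d)
        \<le> real (n choose d) * (1 + 2 * r) ^ d"
      unfolding d by (simp add: algebra_simps)
  qed
  also have "\<dots> = (\<Sum>d=0..n. real (n choose d) * (1 + 2 * r) ^ d) - 1"
    by (simp add: sum.atLeast_Suc_atMost)
  also have "\<dots> = (2 + 2 * r) ^ n - 1"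
    using binomial_ring[of "1 + 2 * r" 1 n] by (simp add: atLeast0AtMost add.assoc)
  finally have "(1 + 2 * r) * (1 + (\<Sum>d=1..n. real (n choose d) * face_bound r d)) \<le> (2 + 2 * r) ^ n + 2 * r"
    by (simp add: distrib_left)
  also have "\<dots> \<le> (1 + 2 * r) * E"
  proof -
    \<comment> \<open>The ratio of \<open>2 + 2 * r\<close> to \<open>c * r + 1\<close> is largest
      at \<open>r = 1\<close>, since \<open>c \<ge> 1\<close>; this is the reduction to
      \<open>r = 1\<close>.\<close>
    have "0 \<le> (c - 1) * (r - 1)" using c r by simp
    then have "(2 + 2 * r) * (c + 1) \<le> 4 * (c * r + 1)" by (simp add: algebra_simps)
    then have "((2 + 2 * r) * (c + 1)) ^ n \<le> (4 * (c * r + 1)) ^ n"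
      using c r by (intro power_mono) auto
    then have "(2 + 2 * r) ^ n * B \<le> 4 ^ n * E"
      by (simp only: power_mult_distrib B_def E_def)
    also have "\<dots> \<le> (3 * B - 3) * E"
      using sqrt_power_bound[OF True] B E unfolding B_def c_def by (intro mult_right_mono) linarith+
    finally have 1: "(2 + 2 * r) ^ n * B \<le> (3 * B - 3) * E" .
    have "(2 * r - 2) * (B * 1) \<le> (2 * r - 2) * (B * E)"
      using r B E by (intro mult_left_mono) auto
    then have "((2 + 2 * r) ^ n + 2 * r) * B \<le> ((1 + 2 * r) * E) * B"
      using 1 E B by (simp add: algebra_simps)
    then show ?thesis using B by simp
  qed
  finally show ?thesis using r by (simp add: E_def c_def)
next
  case False
  have low: "(a * r + 1) ^ n \<le> (sqrt (real n) * r + 1) ^ n" if "0 \<le> a" "a\<^sup>2 \<le> real n" for a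
  proof -
    have "a \<le> sqrt (real n)" using that by (intro real_le_rsqrt)
    then have "a * r \<le> sqrt (real n) * r" using r by (intro mult_right_mono) auto
    then show ?thesis using that r by (intro power_mono) auto
  qed
  obtain t where t: "0 < t" "r = 1 + t" using r by (metis add.commute diff_add_cancel diff_gt_0_iff_gt)
  have t0: "0 \<le> t ^ 2" "0 \<le> t ^ 3" "0 \<le> t ^ 4" using t by auto
  consider "n = 1" | "n = 2" | "n = 3" | "n = 4" using n False by linarith
  then show ?thesis
  proof cases
    case 1
    then show ?thesis using r by (simp add: face_bound_def)
  next
    case 2
    have "{1..2::nat} = {1, 2}" by auto
    then have "1 + (\<Sum>d=1..n. real (n choose d) * face_bound r d) = 4 + r"
      using 2 by (simp add: face_bound_def)
    also have "\<dots> = 5 + t" using t by simp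
    also have "\<dots> \<le> 5 + t + (196 / 100 * t ^ 2 + 572 / 100 * t + 76 / 100)"
      using t(1) t0 by linarith
    also have "\<dots> = (7 / 5 * r + 1) ^ n"
      unfolding 2 t(2) by (simp add: field_simps power2_eq_square)
    also have "\<dots> \<le> (sqrt (real n) * r + 1) ^ n" by (rule low) (use 2 in \<open>simp_all add: power_divide\<close>)
    finally show ?thesis .
  next
    case 3
    have "{1..3::nat} = {1, 2, 3}" by auto
    then have "1 + (\<Sum>d=1..n. real (n choose d) * face_bound r d) = 7 + 3 * r + (1 + 2 * r) ^ 2"
      using 3 by (simp add: face_bound_def choose_two)
    also have "\<dots> = 19 + 15 * t + 4 * t ^ 2" using t by (simp add: algebra_simps power2_eq_square)
    also have "\<dots> \<le> 19 + 15 * t + 4 * t ^ 2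
        + (4913 / 1000 * t ^ 3 + 19409 / 1000 * t ^ 2 + 22179 / 1000 * t + 683 / 1000)"
      using t(1) t0 by linarith
    also have "\<dots> = (17 / 10 * r + 1) ^ n"
      unfolding 3 t(2) by (simp add: field_simps power2_eq_square power3_eq_cube)
    also have "\<dots> \<le> (sqrt (real n) * r + 1) ^ n" by (rule low) (use 3 in \<open>simp_all add: power_divide\<close>)
    finally show ?thesis .
  next
    case 4
    have "{1..4::nat} = {1, 2, 3, 4}" by auto
    moreover have "(4 choose 2 :: nat) = 6" "(4 choose 3 :: nat) = 4" "(4 choose 4 :: nat) = 1"
      by (simp_all add: eval_nat_numeral)
    ultimately have "1 + (\<Sum>d=1..n. real (n choose d) * face_bound r d)
        = 11 + 6 * r + 4 * (1 + 2 * r) ^ 2 + (1 + 2 * r) ^ 3"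
      using 4 by (simp add: face_bound_def)
    also have "\<dots> = 80 + 108 * t + 52 * t ^ 2 + 8 * t ^ 3"
      using t by (simp add: algebra_simps power2_eq_square power3_eq_cube)
    also have "\<dots> \<le> 80 + 108 * t + 52 * t ^ 2 + 8 * t ^ 3
        + (1 + 108 * t + 164 * t ^ 2 + 88 * t ^ 3 + 16 * t ^ 4)"
      using t(1) t0 by linarith
    also have "\<dots> = (2 * r + 1) ^ n"
      unfolding 4 t(2) by (simp add: algebra_simps power2_eq_square power3_eq_cube power4_eq_xxxx)
    also have "\<dots> \<le> (sqrt (real n) * r + 1) ^ n" by (rule low) (use 4 in simp_all)
    finally show ?thesis .
  qed
qed

lemma card_le_sum_faces:
  fixes s :: "'b \<Rightarrow> 'n::finite set"
  assumes "finite J" and ne: "\<And>j. j \<in> J \<Longrightarrow> s j \<noteq> {}"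
    and fiber: "\<And>S. S \<noteq> {} \<Longrightarrow> real (card {j\<in>J. s j = S}) \<le> h (card S)"
  shows "real (card J) \<le> (\<Sum>d=1..CARD('n). real (CARD('n) choose d) * h d)"
proof -
  let ?F = "{S :: 'n set. S \<noteq> {}}"
  have "card J \<le> card (\<Union>S\<in>?F. {j\<in>J. s j = S})"
    using ne \<open>finite J\<close> by (intro card_mono) auto
  also have "\<dots> \<le> (\<Sum>S\<in>?F. card {j\<in>J. s j = S})" by (rule card_UN_le) simp
  finally have "real (card J) \<le> (\<Sum>S\<in>?F. real (card {j\<in>J. s j = S}))" by (simp only: of_nat_le_iff flip: of_nat_sum)
  also have "\<dots> \<le> (\<Sum>S\<in>?F. h (card S))" using fiber by (intro sum_mono) auto
  also have "\<dots> = (\<Sum>d=1..CARD('n). \<Sum>S | S \<in> ?F \<and> card S = d. h (card S))"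
    by (rule sum.group[symmetric]) (auto simp: card_mono Suc_le_eq card_gt_0_iff)
  also have "\<dots> = (\<Sum>d=1..CARD('n). real (CARD('n) choose d) * h d)"
  proof (rule sum.cong[OF refl])
    fix d assume "d \<in> {1..CARD('n)}"
    then have "{S \<in> ?F. card S = d} = {S. S \<subseteq> UNIV \<and> card S = d}" by auto
    then have "card {S \<in> ?F. card S = d} = CARD('n) choose d" using n_subsets[of "UNIV :: 'n set" d] by simp
    then show "(\<Sum>S | S \<in> ?F \<and> card S = d. h (card S)) = real (CARD('n) choose d) * h d" by simp
  qed
  finally show ?thesis .
qed

section \<open>Faces of the first-stage polyhedron\<close>

text \<open>Otherwise \<open>b = 0\<close> and the whole ray through \<open>x\<close> is feasible,
  so the polyhedron is unbounded.\<close>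

lemma matrix_kernel_of_bounded_first_stage:
  assumes bd: "bounded (first_stage A b)" and x: "x \<in> first_stage A b" "x \<noteq> 0"
  shows "A *v x \<noteq> 0"
proof
  assume Ax: "A *v x = 0"
  obtain B where B: "\<And>y. y \<in> first_stage A b \<Longrightarrow> norm y \<le> B"
    using bd by (auto simp: bounded_iff)
  define t where "t = 1 + \<bar>B\<bar> / norm x"
  have "1 \<le> t" by (simp add: t_def)
  then have "t *\<^sub>R x \<in> first_stage A b"
    using x Ax by (auto simp: first_stage_def less_eq_vec_def matrix_vector_mult_scaleR)
  then have "t * norm x \<le> B" using B[of "t *\<^sub>R x"] \<open>1 \<le> t\<close> by simp
  moreover have "t * norm x = norm x + \<bar>B\<bar>" using x(2) by (simp add: t_def field_simps)
  moreover have "0 < norm x" using x(2) by simp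
  ultimately show False by linarith
qed

text \<open>If \<open>S\<close> is the support of a feasible point, this is the direction space of
  the affine hull of the feasible points with support \<open>S\<close>.\<close>

definition face_directions :: "real^'n^'p \<Rightarrow> 'n set \<Rightarrow> (real^'n) set" where
  "face_directions A S = {v. A *v v = 0 \<and> (\<forall>i. i \<notin> S \<longrightarrow> v $ i = 0)}"

lemma subspace_face_directions: "subspace (face_directions A S)"
  by (auto simp: subspace_def face_directions_def matrix_vector_right_distrib matrix_vector_mult_scaleR)

text \<open>The point itself lies in the coordinate subspace of its support but, by boundedness, not in
  the kernel of the matrix; this is where one dimension is gained.\<close>

lemma dim_face_directions:
  fixes A :: "real^'n^'p"
  assumes "bounded (first_stage A b)" and x: "x \<in> first_stage A b" "x \<noteq> 0"
  shows "dim (face_directions A {i. x $ i \<noteq> 0}) < card {i. x $ i \<noteq> 0}"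
proof -
  let ?S = "{i. x $ i \<noteq> 0}"
  define T where "T = {v :: real^'n. \<forall>i. i \<notin> ?S \<longrightarrow> v $ i = 0}"
  have T: "subspace T" by (simp add: T_def subspace_def)
  have "x \<in> T" by (simp add: T_def)
  moreover have "x \<notin> face_directions A ?S"
    using matrix_kernel_of_bounded_first_stage[OF assms] by (simp add: face_directions_def)
  moreover have "face_directions A ?S \<subseteq> T" by (auto simp: face_directions_def T_def)
  ultimately have "face_directions A ?S \<subset> T" by blast
  then have "dim (face_directions A ?S) < dim T"
    using T subspace_face_directions[of A ?S] by (intro dim_psubset) (simp add: span_eq_iff[THEN iffD2])
  also have "dim T = card ?S"
    unfolding T_def dim_vec_eq[symmetric] by (rule dim_substandard_cart)
  finally show ?thesis .
qed

section \<open>Separation of points with the same support\<close>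

text \<open>Coordinates that vanish at \<open>p\<close> vanish at \<open>y\<close> too and stay 0
  along the line; the others are positive at \<open>p\<close> and survive a small step.\<close>

lemma extend_beyond_same_support:
  fixes A :: "real^'n^'p"
  assumes p: "p \<in> first_stage A b" and y: "y \<in> first_stage A b"
    and supp: "\<And>i. p $ i = 0 \<Longrightarrow> y $ i = 0"
  shows "\<exists>t>0. p + t *\<^sub>R (p - y) \<in> first_stage A b"
proof -
  \<comment> \<open>A step length that keeps coordinate \<open>i\<close> nonnegative; the summand 1
    avoids a zero denominator.\<close>
  define s where "s i = (if p $ i = 0 then 1 else p $ i / (\<bar>y $ i\<bar> + 1))" for i
  define t where "t = Min (range s)"
  have p0: "0 \<le> p $ i" for i using p by (auto simp: first_stage_def less_eq_vec_def)
  have "0 < s i" for i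
    using p0[of i] unfolding s_def by (auto intro!: divide_pos_pos)
  then have t: "0 < t" unfolding t_def by (subst Min_gr_iff) auto
  have "t * y $ i \<le> p $ i" for i
  proof (cases "p $ i = 0")
    case False
    have "t * y $ i \<le> t * (\<bar>y $ i\<bar> + 1)" using t by (intro mult_left_mono) auto
    also have "t \<le> s i" unfolding t_def by (rule Min_le) auto
    then have "t * (\<bar>y $ i\<bar> + 1) \<le> s i * (\<bar>y $ i\<bar> + 1)" by (intro mult_right_mono) auto
    also have "\<dots> = p $ i" using False by (simp add: s_def)
    finally show ?thesis .
  qed (simp add: supp)
  then have le: "t * y $ i \<le> p $ i" for i .
  have "0 \<le> (p + t *\<^sub>R (p - y)) $ i" for i
  proof -
    have "0 \<le> t * p $ i" using p0[of i] t by simp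
    then have "0 \<le> p $ i + (t * p $ i - t * y $ i)" using le[of i] by linarith
    then show ?thesis by (simp add: right_diff_distrib)
  qed
  moreover have "A *v (p + t *\<^sub>R (p - y)) = b"
    using p y by (simp add: first_stage_def matrix_vector_right_distrib matrix_vector_mult_scaleR
        matrix_vector_mult_diff_distrib)
  ultimately show ?thesis using t by (auto simp: first_stage_def less_eq_vec_def)
qed

text \<open>A convex minorant that touches a Lipschitz function at \<open>p\<close> need not be Lipschitz.  It cannot
  descend quickly from \<open>p\<close> towards \<open>y\<close>, however, if the segment can be prolonged beyond \<open>p\<close>.\<close>

lemma convex_minorant_separation:
  fixes g :: "'v::real_normed_vector \<Rightarrow> ereal"
  assumes conv: "\<And>\<mu> \<nu> x y a b. 0 \<le> \<mu> \<Longrightarrow> 0 \<le> \<nu> \<Longrightarrow> \<mu> + \<nu> = 1 \<Longrightarrow> g x \<le> ereal a \<Longrightarrow> g y \<le> ereal b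
      \<Longrightarrow> g (\<mu> *\<^sub>R x + \<nu> *\<^sub>R y) \<le> ereal (\<mu> * a + \<nu> * b)"
    and minor: "\<And>x. x \<in> X \<Longrightarrow> g x \<le> ereal (\<phi> x)" and touch: "g p = ereal (\<phi> p)"
    and lip: "L-lipschitz_on X \<phi>" and p: "p \<in> X"
    and t: "0 < t" "p + t *\<^sub>R (p - y) \<in> X"
    and y: "g y \<le> ereal a" "a < \<phi> p - \<epsilon>"
  shows "\<epsilon> < L * dist p y"
proof -
  define z where "z = p + t *\<^sub>R (p - y)"
  have z: "z \<in> X" using t by (simp add: z_def)
  have "\<phi> z \<le> \<phi> p + L * dist z p"
    using lipschitz_onD[OF lip z p] by (simp add: dist_real_def)
  also have "dist z p = t * dist p y" using t by (simp add: z_def dist_norm)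
  finally have gz: "g z \<le> ereal (\<phi> p + L * (t * dist p y))"
    using minor[OF z] by (meson ereal_less_eq(3) order_trans)
  have "p = (1 / (1 + t)) *\<^sub>R z + (t / (1 + t)) *\<^sub>R y"
  proof -
    have "(1 + t) *\<^sub>R p = z + t *\<^sub>R y" by (simp add: z_def algebra_simps)
    then have "(1 / (1 + t)) *\<^sub>R ((1 + t) *\<^sub>R p) = (1 / (1 + t)) *\<^sub>R (z + t *\<^sub>R y)" by simp
    then show ?thesis using t by (simp add: scaleR_add_right)
  qed
  then have "ereal (\<phi> p) \<le> ereal (1 / (1 + t) * (\<phi> p + L * (t * dist p y)) + t / (1 + t) * a)"
    using conv[of "1 / (1 + t)" "t / (1 + t)", OF _ _ _ gz y(1)] touch t
    by (simp add: add_divide_distrib[symmetric])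
  then have "\<phi> p \<le> (\<phi> p + L * (t * dist p y) + t * a) / (1 + t)"
    by (simp add: add_divide_distrib)
  then have "(1 + t) * \<phi> p \<le> \<phi> p + L * (t * dist p y) + t * a"
    using t by (simp add: pos_le_divide_eq mult.commute)
  then have "t * \<phi> p \<le> t * (L * dist p y + a)" by (simp add: algebra_simps)
  then have "\<phi> p \<le> L * dist p y + a" using t by simp
  with y(2) show ?thesis by linarith
qed

lemma partition_cost_convex:
  assumes "prob_space M" "integrable M \<xi>" "dual_feasible W q \<noteq> {}" "finite_ae_partition M \<xi> \<P>"
    and "0 \<le> \<mu>" "0 \<le> \<nu>" "\<mu> + \<nu> = 1"
    and "partition_cost M \<xi> W q c \<P> x \<le> ereal a" "partition_cost M \<xi> W q c \<P> y \<le> ereal b"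
  shows "partition_cost M \<xi> W q c \<P> (\<mu> *\<^sub>R x + \<nu> *\<^sub>R y) \<le> ereal (\<mu> * a + \<nu> * b)"
proof -
  have "partition_recourse M \<xi> W q \<P> x \<le> ereal (a - c \<bullet> x)"
    using assms(8) unfolding partition_cost_def by (cases "partition_recourse M \<xi> W q \<P> x") auto
  moreover have "partition_recourse M \<xi> W q \<P> y \<le> ereal (b - c \<bullet> y)"
    using assms(9) unfolding partition_cost_def by (cases "partition_recourse M \<xi> W q \<P> y") auto
  ultimately have "partition_recourse M \<xi> W q \<P> (\<mu> *\<^sub>R x + \<nu> *\<^sub>R y)
      \<le> ereal (\<mu> * (a - c \<bullet> x) + \<nu> * (b - c \<bullet> y))"
    by (rule partition_recourse_convex[OF assms(1-7)])
  then show ?thesis unfolding partition_cost_def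
    by (cases "partition_recourse M \<xi> W q \<P> (\<mu> *\<^sub>R x + \<nu> *\<^sub>R y)") (auto simp: inner_add_right algebra_simps)
qed

lemma eps_solutionI:
  assumes "y \<in> X" "\<And>x. x \<in> X \<Longrightarrow> total_cost M \<xi> W q c x = ereal (\<phi> x)"
    and "\<And>x. x \<in> X \<Longrightarrow> \<phi> y \<le> \<phi> x + \<epsilon>"
  shows "eps_solution M \<xi> W q c X \<epsilon> y"
proof -
  have "ereal (\<phi> y - \<epsilon>) \<le> (INF x\<in>X. total_cost M \<xi> W q c x)"
    using assms(2,3) by (intro INF_greatest) (simp add: algebra_simps)
  then have "ereal (\<phi> y - \<epsilon>) + ereal \<epsilon> \<le> (INF x\<in>X. total_cost M \<xi> W q c x) + ereal \<epsilon>"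
    by (rule add_right_mono)
  then show ?thesis using assms(1,2) by (simp add: eps_solution_def)
qed

text \<open>Points with common support \<open>S\<close> differ by elements of
  \<open>face_directions A S\<close>, of dimension less than \<open>card S\<close>, and are more
  than \<open>\<epsilon> / L\<close> apart. The packing bounds count them, and summing over supports
  gives the total. The points form an indexed family, which the separation makes injective within
  each support.\<close>

lemma card_separated_by_support:
  fixes x :: "'i \<Rightarrow> real^'n" and A :: "real^'n^'p"
  assumes "finite J" and X: "\<And>j. j \<in> J \<Longrightarrow> x j \<in> first_stage A b" and ne: "\<And>j. j \<in> J \<Longrightarrow> x j \<noteq> 0"
    and bd: "bounded (first_stage A b)" and diam: "diameter (first_stage A b) = D"
    and pos: "0 < \<epsilon>" "0 < L"
    and sep: "\<And>i j. i \<in> J \<Longrightarrow> j \<in> J \<Longrightarrow> i \<noteq> j \<Longrightarrow> {k. x i $ k \<noteq> 0} = {k. x j $ k \<noteq> 0}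
        \<Longrightarrow> \<epsilon> < L * dist (x i) (x j)"
  shows "real (card J) \<le> (\<Sum>d=1..CARD('n). real (CARD('n) choose d) * face_bound (L * D / \<epsilon>) d)"
proof -
  define s where "s j = {k. x j $ k \<noteq> 0}" for j
  let ?r = "L * D / \<epsilon>"
  have D: "0 \<le> D" using diameter_ge_0[OF bd] diam by simp
  have r: "0 \<le> ?r" using D pos by simp
  have fiber: "real (card {j\<in>J. s j = S}) \<le> face_bound ?r (card S)" if "S \<noteq> {}" for S
  proof (cases "{j\<in>J. s j = S} = {}")
    case True
    have "0 \<le> face_bound ?r (card S)" using r by (simp add: face_bound_def)
    then show ?thesis by (simp only: True card.empty of_nat_0)
  next
    case False
    then obtain k where k: "k \<in> J" "s k = S" by blast
    let ?U = "face_directions A S"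
    let ?P = "x ` {j\<in>J. s j = S}"
    have dim: "dim ?U < card S"
      using dim_face_directions[OF bd X[OF k(1)] ne[OF k(1)]] k(2) by (simp add: s_def)
    have sep': "\<epsilon> / L < dist (x i) (x j)" if "i \<in> J" "s i = S" "j \<in> J" "s j = S" "i \<noteq> j" for i j
      using sep[of i j] that pos by (simp add: s_def field_simps)
    have "inj_on x {j\<in>J. s j = S}"
    proof (rule inj_onI, rule ccontr)
      fix i j assume "i \<in> {j\<in>J. s j = S}" "j \<in> {j\<in>J. s j = S}" "x i = x j" "i \<noteq> j"
      with sep'[of i j] show False using pos by (auto simp: divide_less_0_iff)
    qed
    then have card: "card ?P = card {j\<in>J. s j = S}" by (rule card_image)
    have fin: "finite ?P" using \<open>finite J\<close> by simp
    have diff: "u - v \<in> ?U" if "u \<in> ?P" "v \<in> ?P" for u v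
      using that X by (auto simp: face_directions_def s_def first_stage_def matrix_vector_mult_diff_distrib)
    have \<rho>: "0 < \<epsilon> / L" using pos by simp
    have sep_P: "\<epsilon> / L < dist u v" if "u \<in> ?P" "v \<in> ?P" "u \<noteq> v" for u v
      using that sep' by blast
    have diam_P: "dist u v \<le> D" if "u \<in> ?P" "v \<in> ?P" for u v
      using that X diameter_bounded_bound[OF bd] diam by blast
    note packing = packing_subspace[OF fin subspace_face_directions diff \<rho> D sep_P diam_P]
    show ?thesis
    proof (cases "card S = 2")
      case True
      then have "real (card ?P) \<le> 1 + D / (\<epsilon> / L)" using dim by (intro packing(2)) auto
      then show ?thesis using True card by (simp add: face_bound_def mult.commute)
    next
      case False
      have "real (card ?P) \<le> (1 + 2 * D / (\<epsilon> / L)) ^ dim ?U" by (rule packing(1))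
      also have "1 + 2 * D / (\<epsilon> / L) = 1 + 2 * ?r" by (simp add: mult.commute)
      also have "(1 + 2 * ?r) ^ dim ?U \<le> (1 + 2 * ?r) ^ (card S - 1)"
        using dim r by (intro power_increasing) auto
      finally show ?thesis using False card by (simp add: face_bound_def)
    qed
  qed
  have "s j \<noteq> {}" if "j \<in> J" for j using ne[OF that] by (auto simp: s_def vec_eq_iff)
  from card_le_sum_faces[OF \<open>finite J\<close> this fiber] show ?thesis .
qed

section \<open>Executions of the algorithm and the iteration bound\<close>

theorem theorem11:
  fixes M :: "'a measure"
    and \<xi> :: "'a \<Rightarrow> (real^'n^'l) \<times> (real^'l)"
    and W :: "real^'m^'l" and q :: "real^'m" and c :: "real^'n"
    and A :: "real^'n^'p" and b :: "real^'p"
    and X :: "(real^'n) set"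
    and \<epsilon> L D :: real
    and N :: enat
    and x :: "nat \<Rightarrow> real^'n"
    and R \<P> :: "nat \<Rightarrow> ((real^'n^'l) \<times> (real^'l)) set set"
    and zL zU :: "nat \<Rightarrow> ereal"
  assumes "prob_space M"
    and "integrable M \<xi>"
    and "dual_feasible W q \<noteq> {}"
    and "X = first_stage A b"
    and "\<epsilon> > 0"
    and "bounded (X \<inter> recourse_dom M \<xi> W q)"
    and "diameter (X \<inter> recourse_dom M \<xi> W q) = D"
    and "ereal_lipschitz_on L X (total_cost M \<xi> W q c)"
    and "apm_execution M \<xi> W q c X \<epsilon> N x R \<P> zL zU"
  shows "\<exists>k. 1 \<le> k \<and> enat k \<le> N
           \<and> real k \<le> (sqrt (real CARD('n)) * L * D / \<epsilon> + 1) ^ CARD('n)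
           \<and> eps_solution M \<xi> W q c X \<epsilon> (x k)"
proof -
  note setting = assms(1-3)
  let ?F = "total_cost M \<xi> W q c"
  let ?f = "\<lambda>k. partition_cost M \<xi> W q c (\<P> k)"
  let ?sol = "\<lambda>k. eps_solution M \<xi> W q c X \<epsilon> (x k)"
  obtain \<phi> where lip: "L-lipschitz_on X \<phi>" and F: "\<And>y. y \<in> X \<Longrightarrow> ?F y = ereal (\<phi> y)"
    using assms(8) by (auto simp: ereal_lipschitz_on_def)
  \<comment> \<open>The Lipschitz assumption includes finiteness of the cost on \<open>X\<close>, so
    boundedness and the diameter carry over to \<open>X\<close> itself.\<close>
  have "X \<subseteq> recourse_dom M \<xi> W q"
  proof
    fix y assume "y \<in> X"
    from F[OF this] show "y \<in> recourse_dom M \<xi> W q"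
      by (cases "exp_recourse M \<xi> W q y") (auto simp: recourse_dom_def total_cost_def)
  qed
  then have bd: "bounded X" and diam: "diameter X = D"
    using assms(6,7) by (simp_all add: Int_absorb2)
  have L: "0 \<le> L" using lipschitz_on_nonneg[OF lip] .
  have D: "0 \<le> D" using diameter_ge_0[OF bd] diam by simp

  have start: "zU 0 = \<infinity>" "zL 0 = -\<infinity>" "\<P> 0 = {UNIV}"
    and stop: "\<And>n. N = enat n \<Longrightarrow> zU n - zL n \<le> ereal \<epsilon>"
    using assms(9) by (auto simp: apm_execution_def not_less)
  have iter: "x k \<in> X" "\<And>y. y \<in> X \<Longrightarrow> ?f (k - 1) (x k) \<le> ?f (k - 1) y"
      "zL k = ?f (k - 1) (x k)" "adapted_partition M \<xi> W q (x k) (R k)"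
      "\<P> k = common_refinement (\<P> (k - 1)) (R k)" "zU k = min (zU (k - 1)) (?f k (x k))"
    if "1 \<le> k" "enat k \<le> N" for k
    using assms(9) that unfolding apm_execution_def is_arg_min_def by (auto simp: not_less)

  have part: "finite_ae_partition M \<xi> (\<P> k)" if "enat k \<le> N" for k
    using that
  proof (induction k)
    case 0
    show ?case by (simp add: start finite_ae_partition_def)
  next
    case (Suc k)
    then have "finite_ae_partition M \<xi> (\<P> k)"
      using order_trans[of "enat k" "enat (Suc k)" N] by simp
    then show ?case
      using iter(4,5)[of "Suc k"] Suc.prems finite_ae_partition_common_refinement[OF setting]
      by (simp add: adapted_partition_def)
  qed
  have minor: "?f k y \<le> ?F y" if "enat k \<le> N" for k y
    unfolding partition_cost_def total_cost_def
    by (intro add_left_mono partition_recourse_le[OF setting part[OF that]])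
  \<comment> \<open>Refining by the adapted partition \<open>R j\<close> lifts the cost at
    \<open>x j\<close> to the true cost; later refinements can only raise it, and the true cost is
    an upper bound.\<close>
  have touch: "?f k (x j) = ?F (x j)" if "1 \<le> j" "j \<le> k" "enat k \<le> N" for j k
    using that(2,3)
  proof (induction k rule: dec_induct)
    case base
    then have j: "adapted_partition M \<xi> W q (x j) (R j)" "\<P> j = common_refinement (\<P> (j - 1)) (R j)"
      using iter(4,5)[OF that(1)] by auto
    have "enat (j - 1) \<le> N" using base by (metis diff_le_self enat_ord_simps(1) order_trans)
    then have "partition_recourse M \<xi> W q (R j) (x j) \<le> partition_recourse M \<xi> W q (\<P> j) (x j)"
      using j part unfolding j(2) adapted_partition_def by (intro partition_recourse_refine[OF setting]) auto
    then have "?F (x j) \<le> ?f j (x j)"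
      using j(1) by (auto simp: partition_cost_def total_cost_def adapted_partition_def intro: add_left_mono)
    with minor[OF base] show ?case by (rule antisym)
  next
    case (step k)
    have k: "enat k \<le> N" using step.prems by (metis Suc_ile_eq order_less_imp_le)
    have "partition_recourse M \<xi> W q (\<P> k) (x j) \<le> partition_recourse M \<xi> W q (\<P> (Suc k)) (x j)"
      using iter(4,5)[of "Suc k"] step.prems part[OF k]
      by (simp add: adapted_partition_def partition_recourse_refine[OF setting])
    then have "?F (x j) \<le> ?f (Suc k) (x j)"
      using step.IH[OF k] unfolding partition_cost_def by (metis add_left_mono)
    with minor[OF step.prems] show ?case by (rule antisym)
  qed

  \<comment> \<open>The initial gap is infinite, so the loop is entered.\<close>
  have N: "1 \<le> N"
  proof (rule ccontr)
    assume "\<not> 1 \<le> N"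
    then have "N = enat 0" by (cases N) (auto simp: one_enat_def)
    from stop[OF this] show False by (simp add: start)
  qed

  \<comment> \<open>At termination \<open>zU n\<close> is the true cost of some iterate and
    \<open>zL n\<close> is a lower bound on \<open>X\<close>, so this iterate is an
    \<epsilon>-solution.\<close>
  have finite_run: "\<exists>k. 1 \<le> k \<and> k \<le> n \<and> ?sol k" if n: "N = enat n" for n
  proof -
    have n1: "1 \<le> n" using N n by (simp add: one_enat_def)
    have zU: "zU k = \<infinity> \<or> (\<exists>j. 1 \<le> j \<and> j \<le> k \<and> zU k = ?F (x j))" if "k \<le> n" for k
      using that
    proof (induction k)
      case (Suc k)
      have "zU (Suc k) = min (zU k) (?F (x (Suc k)))"
        using iter(6)[of "Suc k"] touch[of "Suc k" "Suc k"] Suc.prems n by simp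
      then show ?case using Suc by (metis Suc_leD le_SucI le_add1 min_def order_refl plus_1_eq_Suc)
    qed (simp add: start)
    have xn: "x n \<in> X" "zL n = ?f (n - 1) (x n)" "zU n \<le> ?F (x n)"
      using iter(1,3,6)[of n] touch[of n n] n1 n by auto
    then obtain j where j: "1 \<le> j" "j \<le> n" "zU n = ?F (x j)"
      using zU[of n] F[OF xn(1)] by auto
    have xj: "x j \<in> X" using iter(1)[of j] j n by simp
    have zL: "zL n \<le> ereal (\<phi> y)" if "y \<in> X" for y
    proof -
      have "zL n \<le> ?f (n - 1) y" using iter(2)[of n y] xn(2) n1 n that by simp
      also have "\<dots> \<le> ?F y" using n by (intro minor) simp
      finally show ?thesis using F[OF that] by simp
    qed
    have gap: "ereal (\<phi> (x j)) - zL n \<le> ereal \<epsilon>" using stop[OF n] j(3) F[OF xj] by simp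
    have "\<phi> (x j) \<le> \<phi> y + \<epsilon>" if "y \<in> X" for y
      using gap zL[OF that] by (cases "zL n") auto
    then have "?sol j" using eps_solutionI[OF xj F] by blast
    with j show ?thesis by blast
  qed

  define r where "r = L * D / \<epsilon>"
  define B where "B = (sqrt (real CARD('n)) * r + 1) ^ CARD('n)"
  have r0: "0 \<le> r" using L D assms(5) by (simp add: r_def)
  have B1: "1 \<le> B" unfolding B_def using r0 by (intro one_le_power) simp
  have "\<exists>k. 1 \<le> k \<and> enat k \<le> N \<and> real k \<le> B \<and> ?sol k"
  proof (cases "r \<le> 1")
    \<comment> \<open>Here \<open>L * D \<le> \<epsilon>\<close>, so the cost varies by at most
      \<epsilon> on \<open>X\<close> and the first iterate already qualifies.\<close>
    case True
    have x1: "x 1 \<in> X" using iter(1)[of 1] N by (simp add: one_enat_def)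
    have "\<phi> (x 1) \<le> \<phi> y + \<epsilon>" if "y \<in> X" for y
    proof -
      have "\<phi> (x 1) - \<phi> y \<le> L * dist (x 1) y"
        using lipschitz_onD[OF lip x1 that] by (simp add: dist_real_def)
      also have "\<dots> \<le> L * D"
        using diameter_bounded_bound[OF bd x1 that] diam L by (intro mult_left_mono) auto
      also have "\<dots> \<le> \<epsilon>" using True assms(5) by (simp add: r_def)
      finally show ?thesis by simp
    qed
    then have "?sol 1" using eps_solutionI[OF x1 F] by blast
    then show ?thesis using N B1 by (intro exI[of _ 1]) (simp add: one_enat_def)
  next
    case False
    have "0 < L" "0 < D" using False L D assms(5) by (auto simp: r_def less_le)
    define K where "K = nat \<lfloor>B\<rfloor>"
    have K: "real K \<le> B" "B < real K + 1" using B1 by (simp_all add: K_def)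
    show ?thesis
    proof (rule ccontr)
      assume "\<not> ?thesis"
      then have none: "\<not> ?sol k" if "1 \<le> k" "enat k \<le> N" "real k \<le> B" for k using that by blast
      \<comment> \<open>A run that stops earlier has found an \<epsilon>-solution, so a
        counterexample performs at least \<open>K\<close> iterations.\<close>
      have KN: "enat K \<le> N"
      proof (rule ccontr)
        assume "\<not> enat K \<le> N"
        then obtain n where n: "N = enat n" "n < K" by (cases N) auto
        from finite_run[OF n(1)] obtain k where "1 \<le> k" "k \<le> n" "?sol k" by blast
        with none[of k] n K(1) show False by simp
      qed
      have run: "1 \<le> k" "enat k \<le> N" "\<not> ?sol k" if "k \<in> {1..K}" for k
      proof -
        show "1 \<le> k" using that by simp
        show "enat k \<le> N" using that KN by (meson atLeastAtMost_iff enat_ord_simps(1) order_trans)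
        then show "\<not> ?sol k" using none[of k] that K(1) by simp
      qed
      have sep: "\<epsilon> < L * dist (x i) (x j)"
        if ij: "i \<in> {1..K}" "j \<in> {1..K}" "i < j" and supp: "{k. x i $ k \<noteq> 0} = {k. x j $ k \<noteq> 0}" for i j
      proof -
        note i = run[OF ij(1)] and j = run[OF ij(2)]
        have xi: "x i \<in> X" and xj: "x j \<in> X" using iter(1) i j by auto
        have j1: "enat (j - 1) \<le> N" using j(2) by (metis diff_le_self enat_ord_simps(1) order_trans)
        \<comment> \<open>A point that beats \<open>x i\<close> by more than \<epsilon>. The
          minimizer \<open>x j\<close> of the partition cost does at least as well as
          \<open>y\<close>, whereas this cost is exact at \<open>x i\<close> because
          \<open>i \<le> j - 1\<close>.\<close>
        obtain y where y: "y \<in> X" "\<phi> y < \<phi> (x i) - \<epsilon>"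
          using i(3) eps_solutionI[OF xi F] by (force simp: not_le)
        have "?f (j - 1) (x j) \<le> ?f (j - 1) y" by (rule iter(2)[OF j(1,2) y(1)])
        also have "\<dots> \<le> ereal (\<phi> y)" using minor[OF j1] F[OF y(1)] by metis
        finally have fj: "?f (j - 1) (x j) \<le> ereal (\<phi> y)" .
        obtain t where t: "0 < t" "x i + t *\<^sub>R (x i - x j) \<in> X"
          using extend_beyond_same_support[of "x i" A b "x j"] xi xj supp assms(4) by blast
        show ?thesis
        proof (rule convex_minorant_separation[OF partition_cost_convex[OF setting part[OF j1]] _ _ lip xi t fj y(2)])
          show "?f (j - 1) y \<le> ereal (\<phi> y)" if "y \<in> X" for y
            using minor[OF j1] F[OF that] by metis
          show "?f (j - 1) (x i) = ereal (\<phi> (x i))"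
            using touch[of i "j - 1"] i(1) ij(3) j1 F[OF xi] by simp
        qed
      qed
      \<comment> \<open>The sum runs over nonempty supports only. If 0 were feasible, boundedness
        would reduce \<open>X\<close> to a single point, against \<open>D > 0\<close>.\<close>
      have nonzero: "x k \<noteq> 0" if "k \<in> {1..K}" for k
      proof
        assume "x k = 0"
        then have "b = 0" "0 \<in> X" using iter(1)[OF run(1,2)[OF that]] assms(4) by (auto simp: first_stage_def)
        then have "X = {0}"
          using matrix_kernel_of_bounded_first_stage[of A b] bd assms(4) by (auto simp: first_stage_def)
        then show False using diam \<open>0 < D\<close> by simp
      qed
      have "real (card {1..K}) \<le> (\<Sum>d=1..CARD('n). real (CARD('n) choose d) * face_bound (L * D / \<epsilon>) d)"
      proof (rule card_separated_by_support)
        show "x k \<in> first_stage A b" if "k \<in> {1..K}" for k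
          using iter(1)[OF run(1,2)[OF that]] assms(4) by simp
        show "\<epsilon> < L * dist (x i) (x j)"
          if "i \<in> {1..K}" "j \<in> {1..K}" "i \<noteq> j" "{k. x i $ k \<noteq> 0} = {k. x j $ k \<noteq> 0}" for i j
          using sep[of i j] sep[of j i] that by (metis dist_commute nat_neq_iff)
      qed (use nonzero bd diam assms(4,5) \<open>0 < L\<close> in auto)
      \<comment> \<open>The extra 1 gives \<open>K + 1 \<le> B\<close>, which contradicts the choice
        of \<open>K\<close> as the integer part of \<open>B\<close>.\<close>
      also have "1 + \<dots> \<le> B"
        using sum_face_bound_le[of "CARD('n)" r] False unfolding B_def r_def by (simp add: Suc_le_eq)
      finally show False using K(2) by simp
    qed
  qed
  then show ?thesis by (simp add: B_def r_def mult.assoc)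
qed

end
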